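(* Let $(A_{ij})_{1\le i<j\le n}$ be generated from the sparse $\beta$-model with true parameter $(\mu_0,\boldsymbol\beta_0)$, and let $s_0=\|\boldsymbol\beta_0\|_0$. Let $M_1,M_2>0$ be deterministic numbers and let $s\in\{1,\dots,n-1\}$ ($M_1,M_2,s,s_0$ may all depend on $n$). Let $$\Theta_s=\{(\mu,\boldsymbol\beta)\in\mathbb R\times[0,\infty)^n: |\mu|\le M_1,\ \boldsymbol\beta\in[0,M_2]^n,\ \|\boldsymbol\beta\|_0\le s\},$$ let $(\hat\mu(s),\hat{\boldsymbol\beta}(s))=\operatorname{argmin}\{\ell_n(\mu,\boldsymbol\beta):(\mu,\boldsymbol\beta)\in\Theta_s\}$, and let $$\mathcal E_s=\mathcal R(\hat\mu(s),\hat{\boldsymbol\beta}(s))-\inf_{(\mu,\boldsymbol\beta)\in\Theta_s}\mathcal R(\mu,\boldsymbol\beta)$$ be the excess risk. For any given $\tau\in(0,1)$, we have $$\mathcal E_s\le\frac{2}{D_+}\Bigg[M_1\left\{\sqrt{2\operatorname{Var}(d_+)\log(4/\tau)}+\frac{\log(4/\tau)}{3}\right\}+M_2 s\left\{\sqrt{2\max_{1\le i\le n}\operatorname{Var}(d_i)\log(4n/\tau)}+\frac{\log(4n/\tau)}{3}\right\}\Bigg]$$ with probability at least $1-\tau$. In particular, if, as $n\to\infty$, $\mu_0=-\gamma\log n+O(1)$ and $\beta_{0i}=\alpha\log n+O(1)$ uniformly in $i\in S(\boldsymbol\beta_0)$ for some $\gamma\in[0,2)$ and $\alpha\in[0,1)$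 with $0\le\gamma-\alpha<1$, and $s_0=o(n^{1-\alpha})$, then $D_+\sim n^{2-\gamma}$ and $$\mathcal E_s=O_P\left(\frac{M_1}{n^{1-\gamma/2}}+\frac{M_2 s\sqrt{\log n}}{n^{3/2-(\gamma+\alpha)/2}}\right).$$
   Context: Sparse $\beta$-model with parameter $(\mu,\boldsymbol\beta)$: an undirected random graph on $\{1,\dots,n\}$ without self-loops with symmetric adjacency matrix $A$, where $(A_{ij})_{i<j}$ are independent Bernoulli random variables with $P(A_{ij}=1)=e^{\mu+\beta_i+\beta_j}/(1+e^{\mu+\beta_i+\beta_j})$, $\mu\in\mathbb R$, $\boldsymbol\beta\in[0,\infty)^n$, $\min_{1\le i\le n}\beta_i=0$. Degrees: $d_i=\sum_{j\neq i}A_{ij}$; number of edges: $d_+=\sum_{i<j}A_{ij}$; $D_+=E[d_+]$. $S(\boldsymbol\beta)=\{i:\beta_i\ne0\}$ and $\|\boldsymbol\beta\|_0=|S(\boldsymbol\beta)|$. All expectations, variances and probabilities are under the true parameter $(\mu_0,\boldsymbol\beta_0)$. Negative log-likelihood: $\ell_n(\mu,\boldsymbol\beta)=-d_+\mu-\sum_{i=1}^n d_i\beta_i+\sum_{1\le i<j\le n}\log(1+e^{\mu+\beta_i+\beta_j})$. Risk: for deterministic $(\mu,\boldsymbol\beta)$, $\mathcal R(\mu,\boldsymbol\beta)=E[D_+^{-1}\ell_n(\mu,\boldsymbol\beta)]$; $\mathcal R(\hat\mu(s),\hat{\boldsymbol\beta}(s))$ denotes this function evaluated at the (random) estimator. For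 positive sequences, $a_n\sim b_n$ means $0<\liminf_{n\to\infty}a_n/b_n\le\limsup_{n\to\infty}a_n/b_n<\infty$. *)

theory Defs
  imports "HOL-Probability.Probability" "HOL-Library.Landau_Symbols"
begin

text \<open>
  A vector in \<open>\<real>\<^sup>n\<close> is a function on \<open>nat\<close> of which only the values on \<open>{1..n}\<close> matter, since \<open>n\<close>
  varies in the asymptotic statements. A graph on \<open>{1..n}\<close> is given by its boolean adjacency
  matrix, and a parameter is a pair \<open>(\<mu>, \<beta>)\<close>.
\<close>

definition vertex_pairs :: "nat \<Rightarrow> (nat \<times> nat) set" where
  "vertex_pairs n = {(i, j). 1 \<le> i \<and> i < j \<and> j \<le> n}"

definition edge_prob :: "real \<Rightarrow> (nat \<Rightarrow> real) \<Rightarrow> nat \<Rightarrow> nat \<Rightarrow> real" where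
  "edge_prob \<mu> \<beta> i j = exp (\<mu> + \<beta> i + \<beta> j) / (1 + exp (\<mu> + \<beta> i + \<beta> j))"

definition support :: "nat \<Rightarrow> (nat \<Rightarrow> real) \<Rightarrow> nat set" where
  "support n \<beta> = {i \<in> {1..n}. \<beta> i \<noteq> 0}"

definition l0norm :: "nat \<Rightarrow> (nat \<Rightarrow> real) \<Rightarrow> nat" where
  "l0norm n \<beta> = card (support n \<beta>)"

locale sparse_beta_model = prob_space M
  for M :: "'w measure" +
  fixes n :: nat
    and A :: "'w \<Rightarrow> nat \<Rightarrow> nat \<Rightarrow> bool"
    and \<mu>\<^sub>0 :: real
    and \<beta>\<^sub>0 :: "nat \<Rightarrow> real"
  assumes n_pos: "1 \<le> n"
    and beta0_nonneg: "\<And>i. i \<in> {1..n} \<Longrightarrow> 0 \<le> \<beta>\<^sub>0 i"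
    and beta0_min: "Min (\<beta>\<^sub>0 ` {1..n}) = 0"
    and no_loops: "\<And>\<omega> i. \<omega> \<in> space M \<Longrightarrow> i \<in> {1..n} \<Longrightarrow> \<not> A \<omega> i i"
    and symmetric: "\<And>\<omega> i j. \<omega> \<in> space M \<Longrightarrow> i \<in> {1..n} \<Longrightarrow> j \<in> {1..n} \<Longrightarrow> A \<omega> i j = A \<omega> j i"
    and indep_edges:
      "indep_vars (\<lambda>_. count_space UNIV) (\<lambda>(i, j) \<omega>. A \<omega> i j) (vertex_pairs n)"
    and bernoulli_edges: "\<And>i j. (i, j) \<in> vertex_pairs n \<Longrightarrow>
      distr M (count_space UNIV) (\<lambda>\<omega>. A \<omega> i j)
        = measure_pmf (bernoulli_pmf (edge_prob \<mu>\<^sub>0 \<beta>\<^sub>0 i j))"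

definition vertex_degree :: "nat \<Rightarrow> (nat \<Rightarrow> nat \<Rightarrow> bool) \<Rightarrow> nat \<Rightarrow> real" where
  "vertex_degree n a i = (\<Sum>j\<in>{1..n} - {i}. of_bool (a i j))"

definition num_edges :: "nat \<Rightarrow> (nat \<Rightarrow> nat \<Rightarrow> bool) \<Rightarrow> real" where
  "num_edges n a = (\<Sum>(i, j)\<in>vertex_pairs n. of_bool (a i j))"

definition neg_log_lik ::
  "nat \<Rightarrow> (nat \<Rightarrow> nat \<Rightarrow> bool) \<Rightarrow> real \<times> (nat \<Rightarrow> real) \<Rightarrow> real" where
  "neg_log_lik n a = (\<lambda>(\<mu>, \<beta>).
     - num_edges n a * \<mu> - (\<Sum>i=1..n. vertex_degree n a i * \<beta> i)
     + (\<Sum>(i, j)\<in>vertex_pairs n. ln (1 + exp (\<mu> + \<beta> i + \<beta> j))))"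

definition expected_edges :: "'w measure \<Rightarrow> nat \<Rightarrow> ('w \<Rightarrow> nat \<Rightarrow> nat \<Rightarrow> bool) \<Rightarrow> real" where
  "expected_edges M n A = prob_space.expectation M (\<lambda>\<omega>. num_edges n (A \<omega>))"

definition risk ::
  "'w measure \<Rightarrow> nat \<Rightarrow> ('w \<Rightarrow> nat \<Rightarrow> nat \<Rightarrow> bool) \<Rightarrow> real \<times> (nat \<Rightarrow> real) \<Rightarrow> real" where
  "risk M n A \<theta> =
     prob_space.expectation M (\<lambda>\<omega>. inverse (expected_edges M n A) * neg_log_lik n (A \<omega>) \<theta>)"

definition param_space :: "nat \<Rightarrow> real \<Rightarrow> real \<Rightarrow> nat \<Rightarrow> (real \<times> (nat \<Rightarrow> real)) set" where
  "param_space n M\<^sub>1 M\<^sub>2 s =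
     {(\<mu>, \<beta>). \<bar>\<mu>\<bar> \<le> M\<^sub>1 \<and> \<beta> \<in> {1..n} \<rightarrow> {0..M\<^sub>2} \<and> l0norm n \<beta> \<le> s}"

text \<open>
  The minimiser need not be unique: the estimator is any random variable that is a minimiser at
  every outcome. Measurability is required coordinatewise.
\<close>

definition constrained_mle ::
  "'w measure \<Rightarrow> nat \<Rightarrow> ('w \<Rightarrow> nat \<Rightarrow> nat \<Rightarrow> bool) \<Rightarrow> real \<Rightarrow> real \<Rightarrow> nat
     \<Rightarrow> ('w \<Rightarrow> real \<times> (nat \<Rightarrow> real)) \<Rightarrow> bool" where
  "constrained_mle M n A M\<^sub>1 M\<^sub>2 s \<theta>hat \<longleftrightarrow>
     (\<lambda>\<omega>. fst (\<theta>hat \<omega>)) \<in> borel_measurable M \<and>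
     (\<forall>i\<in>{1..n}. (\<lambda>\<omega>. snd (\<theta>hat \<omega>) i) \<in> borel_measurable M) \<and>
     (\<forall>\<omega>\<in>space M. is_arg_min (neg_log_lik n (A \<omega>)) (\<lambda>\<theta>. \<theta> \<in> param_space n M\<^sub>1 M\<^sub>2 s) (\<theta>hat \<omega>))"

definition excess_risk ::
  "'w measure \<Rightarrow> nat \<Rightarrow> ('w \<Rightarrow> nat \<Rightarrow> nat \<Rightarrow> bool) \<Rightarrow> real \<Rightarrow> real \<Rightarrow> nat
     \<Rightarrow> ('w \<Rightarrow> real \<times> (nat \<Rightarrow> real)) \<Rightarrow> 'w \<Rightarrow> real" where
  "excess_risk M n A M\<^sub>1 M\<^sub>2 s \<theta>hat \<omega> =
     risk M n A (\<theta>hat \<omega>) - (INF \<theta>\<in>param_space n M\<^sub>1 M\<^sub>2 s. risk M n A \<theta>)"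

definition same_order :: "(nat \<Rightarrow> real) \<Rightarrow> (nat \<Rightarrow> real) \<Rightarrow> bool" where
  "same_order a b \<longleftrightarrow>
     0 < liminf (\<lambda>n. ereal (a n / b n)) \<and> limsup (\<lambda>n. ereal (a n / b n)) < \<infinity>"

text \<open>
  \<open>X n = O\<^sub>P(a n)\<close>. The bound is on the probability of the good event from below because
  \<^const>\<open>measure\<close> is \<open>0\<close> on non-measurable sets, so that no measurability is left implicit.
\<close>

definition bigO_in_prob ::
  "(nat \<Rightarrow> 'w measure) \<Rightarrow> (nat \<Rightarrow> 'w \<Rightarrow> real) \<Rightarrow> (nat \<Rightarrow> real) \<Rightarrow> bool" where
  "bigO_in_prob M X a \<longleftrightarrow>
     (\<forall>\<epsilon>>0. \<exists>K>0. \<forall>\<^sub>F n in sequentially.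
        measure (M n) {\<omega> \<in> space (M n). \<bar>X n \<omega>\<bar> \<le> K * a n} \<ge> 1 - \<epsilon>)"

end

theory Submission imports Defs begin

text \<open>
  The data enter the negative log-likelihood linearly, through the number of edges \<open>d\<^sub>+\<close> and the
  degrees \<open>d\<^sub>i\<close>, while the logarithmic terms are deterministic. Hence its value at a parameter
  \<open>(\<mu>, \<beta>)\<close> differs from its mean, which is \<open>D\<^sub>+\<close> times the risk, by exactly
  \<open>(d\<^sub>+ - D\<^sub>+) \<mu> + (\<Sum>i. (d\<^sub>i - E d\<^sub>i) \<beta>\<^sub>i)\<close> up to sign. On the parameter space this is at most
  \<open>M\<^sub>1 \<bar>d\<^sub>+ - D\<^sub>+\<bar> + M\<^sub>2 s (max\<^sub>i \<bar>d\<^sub>i - E d\<^sub>i\<bar>)\<close>, because at most \<open>s\<close> coordinates of \<open>\<beta>\<close> are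
  nonzero (\<open>sparse_inner_product_le\<close>). The bound is uniform in the parameter, so the minimiser of the
  likelihood loses at most twice as much against the best risk (\<open>excess_risk_le\<close>).

  It remains to control \<open>d\<^sub>+\<close> and the degrees, which are sums of independent Bernoulli variables. With
  \<open>V\<close> the variance, inverting the usual exponent \<open>t\<^sup>2 / (2 (V + t / 3)) = L\<close> of Bernstein's
  inequality gives \<open>t = L / 3 + \<surd>(2 V L + L\<^sup>2 / 9)\<close>, which is larger than \<open>\<surd>(2 V L) + L / 3\<close>; so the
  exponential moment is optimised directly for the latter (\<open>Bernstein_ineq_ge\<close>). Deviations of the
  edge count and of the degrees each get failure probability \<open>\<tau> / 2\<close>; for the degrees it is divided
  among the \<open>n\<close> vertices, whence the factor \<open>n\<close> inside the logarithm.

  For the asymptotics, an edge probability is at most \<open>e\<^sup>\<mu> e\<^bsup>\<beta> i\<^esup> e\<^bsup>\<beta> j\<^esup>\<close>. The vertices with a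
  nonzero \<open>\<beta>\<^sub>i\<close> have weight \<open>O(n\<^sup>\<alpha>)\<close> and there are \<open>o(n\<^bsup>1-\<alpha>\<^esup>)\<close> of them, so the weights sum up
  to \<open>O(n)\<close>. This gives \<open>D\<^sub>+ = O(n\<^bsup>2-\<gamma>\<^esup>)\<close> and \<open>E d\<^sub>i = O(n\<^bsup>1-\<gamma>+\<alpha>\<^esup>)\<close>, and these means dominate the
  variances. Conversely \<open>\<beta> \<ge> 0\<close> makes every edge at least as likely as for \<open>\<beta> = 0\<close>, so that
  \<open>D\<^sub>+\<close> has order exactly \<open>n\<^bsup>2-\<gamma>\<^esup>\<close>. As \<open>2 - \<gamma>\<close> and \<open>1 - \<gamma> + \<alpha>\<close> are positive, the square roots
  dominate the logarithmic remainders, and the rate follows (\<open>excess_bound_le_rate\<close>).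
\<close>

section \<open>Bernstein's inequality and variances of independent sums\<close>

lemma two_mult_three_power_le_fact: "2 * 3 ^ k \<le> (fact (k + 2) :: real)"
proof (induction k)
  case (Suc k)
  have "2 * 3 ^ Suc k \<le> real (k + 3) * (2 * 3 ^ k)"
    by simp
  also have "\<dots> \<le> real (k + 3) * fact (k + 2)"
    by (intro mult_left_mono Suc.IH) auto
  also have "\<dots> = fact (Suc k + 2)"
    by (simp add: algebra_simps numeral_eq_Suc)
  finally show ?case .
qed simp

text \<open>
  Every term of order at least two in the exponential series has the factor \<open>x\<^sup>2\<close>, and \<open>\<bar>x\<bar> \<le> 1\<close> bounds
  the rest of it. With \<open>k! \<ge> 2 \<cdot> 3\<^bsup>k-2\<^esup>\<close> the tail is dominated by a geometric series of ratio
  \<open>l / 3\<close>. Keeping \<open>x\<^sup>2\<close> is what lets the variance appear after taking expectations.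
\<close>
lemma exp_le_quadratic:
  fixes l x :: real
  assumes "\<bar>x\<bar> \<le> 1" "0 \<le> l" "l < 3"
  shows "exp (l * x) \<le> 1 + l * x + x\<^sup>2 * (l\<^sup>2 / (2 * (1 - l / 3)))"
proof -
  have exp_sums: "(\<lambda>k. (l * x) ^ k / fact k) sums exp (l * x)"
    using exp_converges[of "l * x"] by (simp add: divide_inverse mult.commute)
  have tail: "(\<lambda>k. (l * x) ^ (k + 2) / fact (k + 2)) sums (exp (l * x) - (1 + l * x))"
    using sums_split_initial_segment[OF exp_sums, of 2] by (simp add: numeral_2_eq_2)
  have "(\<lambda>k. (l / 3) ^ k) sums (1 / (1 - l / 3))"
    using assms by (intro geometric_sums) auto
  then have majorant: "(\<lambda>k. x\<^sup>2 * l\<^sup>2 / 2 * (l / 3) ^ k) sums (x\<^sup>2 * l\<^sup>2 / 2 * (1 / (1 - l / 3)))"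
    by (rule sums_mult)
  have "(l * x) ^ (k + 2) / fact (k + 2) \<le> x\<^sup>2 * l\<^sup>2 / 2 * (l / 3) ^ k" for k
  proof -
    have "x ^ k \<le> 1"
      using assms(1) by (metis abs_ge_self abs_ge_zero order.trans power_abs power_le_one)
    then have "x\<^sup>2 * l\<^sup>2 * l ^ k * x ^ k \<le> x\<^sup>2 * l\<^sup>2 * l ^ k * 1"
      using assms(2) by (intro mult_left_mono) auto
    moreover have "(l * x) ^ (k + 2) = x\<^sup>2 * l\<^sup>2 * l ^ k * x ^ k"
      by (simp add: power_mult_distrib power_add power2_eq_square mult_ac)
    ultimately have "(l * x) ^ (k + 2) \<le> x\<^sup>2 * l\<^sup>2 * l ^ k"
      by simp
    then have "(l * x) ^ (k + 2) / fact (k + 2) \<le> x\<^sup>2 * l\<^sup>2 * l ^ k / fact (k + 2)"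
      by (intro divide_right_mono) auto
    also have "\<dots> \<le> x\<^sup>2 * l\<^sup>2 * l ^ k / (2 * 3 ^ k)"
      using assms(2) by (intro divide_left_mono two_mult_three_power_le_fact) auto
    finally show ?thesis
      by (simp add: power_divide)
  qed
  from sums_le[OF this tail majorant] show ?thesis
    by simp
qed

context prob_space
begin

lemma bounded_rv_integrable:
  fixes X :: "'a \<Rightarrow> real"
  assumes "random_variable borel X" "\<And>\<omega>. \<omega> \<in> space M \<Longrightarrow> \<bar>X \<omega>\<bar> \<le> B"
  shows "integrable M X"
  using assms by (intro integrable_const_bound[where B = B]) auto

text \<open>
  Square integrability of the partial sums is carried through the induction because the variance of
  a sum of two variables is expanded through second moments; independence removes the mixed term.
\<close>
lemma variance_sum_indep:
  fixes X :: "'i \<Rightarrow> 'a \<Rightarrow> real"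
  assumes "finite I" "indep_vars (\<lambda>_. borel) X I"
    and int: "\<And>i. i \<in> I \<Longrightarrow> integrable M (X i)"
    and int2: "\<And>i. i \<in> I \<Longrightarrow> integrable M (\<lambda>\<omega>. (X i \<omega>)\<^sup>2)"
  shows "variance (\<lambda>\<omega>. \<Sum>i\<in>I. X i \<omega>) = (\<Sum>i\<in>I. variance (X i))
    \<and> integrable M (\<lambda>\<omega>. (\<Sum>i\<in>I. X i \<omega>)\<^sup>2)"
  using assms
proof (induction I rule: finite_induct)
  case (insert i I)
  define S where "S = (\<lambda>\<omega>. \<Sum>i\<in>I. X i \<omega>)"
  have IH: "variance S = (\<Sum>i\<in>I. variance (X i))" "integrable M (\<lambda>\<omega>. (S \<omega>)\<^sup>2)"
    using insert.IH insert.prems indep_vars_subset[OF insert.prems(1), of I] by (auto simp: S_def)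
  have intS: "integrable M S" and intX: "integrable M (X i)" "integrable M (\<lambda>\<omega>. (X i \<omega>)\<^sup>2)"
    using insert.prems by (auto simp: S_def)
  have indep: "indep_var borel (X i) borel S"
    unfolding S_def using insert by (intro indep_vars_sum) auto
  have prod: "expectation (\<lambda>\<omega>. X i \<omega> * S \<omega>) = expectation (X i) * expectation S"
    and intXS: "integrable M (\<lambda>\<omega>. X i \<omega> * S \<omega>)"
    using indep_var_lebesgue_integral[OF indep intX(1) intS]
      indep_var_integrable[OF indep intX(1) intS] by auto
  have square: "(X i \<omega> + S \<omega>)\<^sup>2 = (X i \<omega>)\<^sup>2 + 2 * (X i \<omega> * S \<omega>) + (S \<omega>)\<^sup>2" for \<omega>
    by (simp add: power2_sum)
  have int_sum2: "integrable M (\<lambda>\<omega>. (X i \<omega> + S \<omega>)\<^sup>2)"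
    unfolding square using intX intXS IH(2) by auto
  have "expectation (\<lambda>\<omega>. (X i \<omega> + S \<omega>)\<^sup>2) = expectation (\<lambda>\<omega>. (X i \<omega>)\<^sup>2)
      + 2 * (expectation (X i) * expectation S) + expectation (\<lambda>\<omega>. (S \<omega>)\<^sup>2)"
    unfolding square prod[symmetric] using intX intXS IH(2) by simp
  then have "variance (\<lambda>\<omega>. X i \<omega> + S \<omega>) = variance (X i) + variance S"
    using variance_eq[OF intX] variance_eq[OF intS IH(2)]
      variance_eq[OF Bochner_Integration.integrable_add[OF intX(1) intS] int_sum2] intX intS
    by (simp add: power2_sum)
  then show ?case
    using insert.hyps int_sum2 IH by (simp add: S_def)
qed simp

lemma exp_scaled_integrable:
  fixes Y :: "'a \<Rightarrow> real"
  assumes "random_variable borel Y" "\<And>\<omega>. \<omega> \<in> space M \<Longrightarrow> \<bar>Y \<omega>\<bar> \<le> 1" "0 \<le> l"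
  shows "integrable M (\<lambda>\<omega>. exp (l * Y \<omega>))"
proof (rule bounded_rv_integrable)
  show "\<bar>exp (l * Y \<omega>)\<bar> \<le> exp l" if "\<omega> \<in> space M" for \<omega>
    using mult_left_mono[of "Y \<omega>" 1 l] assms(2)[OF that] assms(3) by simp
qed (use assms(1) in measurable)

text \<open>
  Taking expectations in the quadratic bound kills the linear term, and \<open>1 + y \<le> e\<^sup>y\<close> turns the result
  into a form that multiplies well over independent variables.
\<close>
lemma exp_moment_le:
  fixes Y :: "'a \<Rightarrow> real"
  assumes rv[measurable]: "random_variable borel Y"
    and bound: "\<And>\<omega>. \<omega> \<in> space M \<Longrightarrow> \<bar>Y \<omega>\<bar> \<le> 1"
    and mean: "expectation Y = 0"
    and l: "0 \<le> l" "l < 3"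
  shows "expectation (\<lambda>\<omega>. exp (l * Y \<omega>)) \<le> exp (expectation (\<lambda>\<omega>. (Y \<omega>)\<^sup>2) * (l\<^sup>2 / (2 * (1 - l / 3))))"
proof -
  have intY: "integrable M Y" "integrable M (\<lambda>\<omega>. (Y \<omega>)\<^sup>2)"
    using bound by (auto intro!: bounded_rv_integrable[where B = 1] abs_square_le_1[THEN iffD2])
  have "expectation (\<lambda>\<omega>. exp (l * Y \<omega>))
      \<le> expectation (\<lambda>\<omega>. 1 + l * Y \<omega> + (Y \<omega>)\<^sup>2 * (l\<^sup>2 / (2 * (1 - l / 3))))"
  proof (rule integral_mono)
    show "integrable M (\<lambda>\<omega>. exp (l * Y \<omega>))"
      by (rule exp_scaled_integrable[OF rv bound l(1)])
    show "integrable M (\<lambda>\<omega>. 1 + l * Y \<omega> + (Y \<omega>)\<^sup>2 * (l\<^sup>2 / (2 * (1 - l / 3))))"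
      using intY by auto
    show "exp (l * Y \<omega>) \<le> 1 + l * Y \<omega> + (Y \<omega>)\<^sup>2 * (l\<^sup>2 / (2 * (1 - l / 3)))"
      if "\<omega> \<in> space M" for \<omega>
      by (rule exp_le_quadratic[OF bound[OF that] l])
  qed
  also have "\<dots> = 1 + expectation (\<lambda>\<omega>. (Y \<omega>)\<^sup>2) * (l\<^sup>2 / (2 * (1 - l / 3)))"
    using intY mean by (simp add: prob_space)
  also have "\<dots> \<le> exp (expectation (\<lambda>\<omega>. (Y \<omega>)\<^sup>2) * (l\<^sup>2 / (2 * (1 - l / 3))))"
    by (rule exp_ge_add_one_self)
  finally show ?thesis .
qed

text \<open>
  Chernoff's bound with the logarithmic moment bound \<open>V l\<^sup>2 / (2 (1 - l / 3))\<close>. The deviation is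
  parametrised by the exponent \<open>L\<close>, so that the threshold is \<open>\<surd>(2 V L) + L / 3\<close>; this
  is smaller than what the form \<open>exp (- t\<^sup>2 / (2 (V + t / 3)))\<close> of the tail bound yields at level
  \<open>exp (- L)\<close>.
\<close>
theorem Bernstein_ineq_ge:
  fixes Y :: "'i \<Rightarrow> 'a \<Rightarrow> real"
  assumes fin: "finite I"
    and indep: "indep_vars (\<lambda>_. borel) Y I"
    and bound: "\<And>i \<omega>. i \<in> I \<Longrightarrow> \<omega> \<in> space M \<Longrightarrow> \<bar>Y i \<omega>\<bar> \<le> 1"
    and mean: "\<And>i. i \<in> I \<Longrightarrow> expectation (Y i) = 0"
    and V: "V = (\<Sum>i\<in>I. expectation (\<lambda>\<omega>. (Y i \<omega>)\<^sup>2))" "0 < V"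
    and L: "0 < L"
  shows "prob {\<omega> \<in> space M. sqrt (2 * V * L) + L / 3 \<le> (\<Sum>i\<in>I. Y i \<omega>)} \<le> exp (- L)"
proof -
  \<comment> \<open>Chernoff's bound for this threshold is optimal at \<open>l = u / (1 + u / 3)\<close>. As
    \<open>V u\<^sup>2 = 2 L\<close>, its exponent is then exactly \<open>- L\<close>.\<close>
  define u where "u = sqrt (2 * L / V)"
  define l where "l = u / (1 + u / 3)"
  define t where "t = sqrt (2 * V * L) + L / 3"
  have u: "0 < u"
    using V L by (simp add: u_def)
  have l: "0 < l" "l < 3"
    using u by (auto simp: l_def field_simps)
  have Vu: "V * u\<^sup>2 = 2 * L"
    using V L by (simp add: u_def)
  have "V * u = sqrt (V\<^sup>2 * (2 * L / V))"
    unfolding u_def real_sqrt_mult[of "V\<^sup>2"] using V by simp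
  also have "V\<^sup>2 * (2 * L / V) = 2 * V * L"
    using V by (simp add: power2_eq_square)
  finally have t: "t = V * u + L / 3"
    by (simp add: t_def)
  have rv[measurable]: "random_variable borel (Y i)" if "i \<in> I" for i
    using indep that by (auto simp: indep_vars_def)
  have int_exp: "integrable M (\<lambda>\<omega>. exp (l * Y i \<omega>))" if "i \<in> I" for i
    using rv[OF that] bound[OF that] l by (intro exp_scaled_integrable) auto
  have indep_exp: "indep_vars (\<lambda>_. borel) (\<lambda>i \<omega>. exp (l * Y i \<omega>)) I"
    by (rule indep_vars_compose2[OF indep]) auto
  have exp_sum_eq: "exp (l * (\<Sum>i\<in>I. Y i \<omega>)) = (\<Prod>i\<in>I. exp (l * Y i \<omega>))" for \<omega>
    by (simp add: sum_distrib_left exp_sum fin)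
  have "prob {\<omega> \<in> space M. t \<le> (\<Sum>i\<in>I. Y i \<omega>)}
      \<le> exp (- l * t) * (\<integral>\<omega>\<in>space M. exp (l * (\<Sum>i\<in>I. Y i \<omega>)) \<partial>M)"
  proof (rule Chernoff_ineq_ge)
    show "set_integrable M (space M) (\<lambda>\<omega>. exp (l * (\<Sum>i\<in>I. Y i \<omega>)))"
      unfolding exp_sum_eq set_integrable_def
      by (intro integrable_mult_indicator indep_vars_integrable fin indep_exp int_exp) auto
  qed (use l in auto)
  also have "(\<integral>\<omega>\<in>space M. exp (l * (\<Sum>i\<in>I. Y i \<omega>)) \<partial>M) = expectation (\<lambda>\<omega>. \<Prod>i\<in>I. exp (l * Y i \<omega>))"
    unfolding exp_sum_eq by (rule set_integral_space) (intro indep_vars_integrable fin indep_exp int_exp)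
  also have "\<dots> = (\<Prod>i\<in>I. expectation (\<lambda>\<omega>. exp (l * Y i \<omega>)))"
    by (intro indep_vars_lebesgue_integral fin indep_exp int_exp)
  also have "exp (- l * t) * \<dots>
      \<le> exp (- l * t) * (\<Prod>i\<in>I. exp (expectation (\<lambda>\<omega>. (Y i \<omega>)\<^sup>2) * (l\<^sup>2 / (2 * (1 - l / 3)))))"
    using l bound mean by (intro mult_left_mono prod_mono conjI exp_moment_le) auto
  also have "\<dots> = exp (V * (l\<^sup>2 / (2 * (1 - l / 3))) - l * t)"
    by (simp only: V(1) sum_distrib_right exp_sum[OF fin, symmetric] exp_add[symmetric])
      (simp add: algebra_simps)
  also have "V * (l\<^sup>2 / (2 * (1 - l / 3))) - l * t = - L"
  proof -
    define w where "w = 1 + u / 3"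
    have w: "0 < w" "l = u / w"
      using u by (simp_all add: w_def l_def)
    then have "1 - l / 3 = (w - u / 3) / w"
      by (simp add: diff_divide_distrib)
    then have one_minus: "1 - l / 3 = 1 / w"
      by (simp add: w_def)
    have "V * (l\<^sup>2 / (2 * (1 - l / 3))) = V * u\<^sup>2 / (2 * w)"
      unfolding one_minus unfolding w(2) using w(1) by (simp add: power2_eq_square)
    also have "\<dots> = L / w"
      unfolding Vu by simp
    finally have quadratic: "V * (l\<^sup>2 / (2 * (1 - l / 3))) = L / w" .
    have "l * t = (V * u\<^sup>2 + u / 3 * L) / w"
      by (simp add: w(2) t power2_eq_square algebra_simps add_divide_distrib)
    also have "\<dots> = L / w + L"
      using w(1) unfolding Vu by (simp add: w_def field_simps)
    finally show ?thesis
      using quadratic by simp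
  qed
  finally show ?thesis
    by (simp add: t_def)
qed

corollary Bernstein_ineq_abs_ge:
  fixes Y :: "'i \<Rightarrow> 'a \<Rightarrow> real"
  assumes fin: "finite I"
    and indep: "indep_vars (\<lambda>_. borel) Y I"
    and bound: "\<And>i \<omega>. i \<in> I \<Longrightarrow> \<omega> \<in> space M \<Longrightarrow> \<bar>Y i \<omega>\<bar> \<le> 1"
    and mean: "\<And>i. i \<in> I \<Longrightarrow> expectation (Y i) = 0"
    and V: "V = (\<Sum>i\<in>I. expectation (\<lambda>\<omega>. (Y i \<omega>)\<^sup>2))" "0 < V"
    and L: "0 < L"
  shows "prob {\<omega> \<in> space M. sqrt (2 * V * L) + L / 3 \<le> \<bar>\<Sum>i\<in>I. Y i \<omega>\<bar>} \<le> 2 * exp (- L)"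
proof -
  let ?t = "sqrt (2 * V * L) + L / 3"
  have rv[measurable]: "random_variable borel (Y i)" if "i \<in> I" for i
    using indep that by (auto simp: indep_vars_def)
  have upper: "prob {\<omega> \<in> space M. ?t \<le> (\<Sum>i\<in>I. Y i \<omega>)} \<le> exp (- L)"
    by (rule Bernstein_ineq_ge) (use assms in auto)
  have lower: "prob {\<omega> \<in> space M. ?t \<le> (\<Sum>i\<in>I. - Y i \<omega>)} \<le> exp (- L)"
  proof (rule Bernstein_ineq_ge)
    show "indep_vars (\<lambda>_. borel) (\<lambda>i \<omega>. - Y i \<omega>) I"
      by (rule indep_vars_compose2[OF indep]) auto
  qed (use assms in auto)
  let ?U = "{\<omega> \<in> space M. ?t \<le> (\<Sum>i\<in>I. Y i \<omega>)}"
  let ?D = "{\<omega> \<in> space M. ?t \<le> (\<Sum>i\<in>I. - Y i \<omega>)}"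
  have "{\<omega> \<in> space M. ?t \<le> \<bar>\<Sum>i\<in>I. Y i \<omega>\<bar>} = ?U \<union> ?D"
    by (auto simp: sum_negf abs_if)
  moreover have "prob (?U \<union> ?D) \<le> prob ?U + prob ?D"
    by (intro measure_Un_le) measurable
  ultimately show ?thesis
    using upper lower by simp
qed

end

section \<open>Concentration and the excess risk in the sparse beta model\<close>

lemma finite_vertex_pairs: "finite (vertex_pairs n)"
  by (rule finite_subset[of _ "{1..n} \<times> {1..n}"]) (auto simp: vertex_pairs_def)

lemma first_pair_mem: "2 \<le> n \<Longrightarrow> (1, 2) \<in> vertex_pairs n"
  by (simp add: vertex_pairs_def)

text \<open>
  The degree of a vertex sums over its row of the symmetric adjacency matrix, whereas independence
  is known for entries above the diagonal. Degrees are therefore rewritten as sums over the pairs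
  \<open>i < j\<close> that contain the vertex.
\<close>
definition incident_pairs :: "nat \<Rightarrow> nat \<Rightarrow> (nat \<times> nat) set" where
  "incident_pairs n i = {e \<in> vertex_pairs n. i = fst e \<or> i = snd e}"

lemma incident_pairs_subset: "incident_pairs n i \<subseteq> vertex_pairs n"
  by (auto simp: incident_pairs_def)

lemma sum_incident_pairs:
  fixes f :: "nat \<Rightarrow> nat \<Rightarrow> 'a :: comm_monoid_add"
  assumes "i \<in> {1..n}" and symm: "\<And>j. j \<in> {1..n} \<Longrightarrow> f i j = f j i"
  shows "(\<Sum>e\<in>incident_pairs n i. f (fst e) (snd e)) = (\<Sum>j\<in>{1..n} - {i}. f i j)"
  by (rule sum.reindex_bij_witness[where j = "\<lambda>e. if fst e = i then snd e else fst e"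
        and i = "\<lambda>j. (min i j, max i j)"])
    (use assms in \<open>auto simp: incident_pairs_def vertex_pairs_def min_def max_def symm split: if_splits\<close>)

lemma edge_prob_bounds: "0 < edge_prob \<mu> \<beta> i j" "edge_prob \<mu> \<beta> i j < 1"
  by (auto simp: edge_prob_def field_simps add_pos_pos)

lemma edge_prob_commute: "edge_prob \<mu> \<beta> i j = edge_prob \<mu> \<beta> j i"
  by (simp add: edge_prob_def add_ac)

lemma neg_log_lik_affine:
  "neg_log_lik n a \<theta> = - num_edges n a * fst \<theta> - (\<Sum>i=1..n. vertex_degree n a i * snd \<theta> i)
     + (\<Sum>(i, j)\<in>vertex_pairs n. ln (1 + exp (fst \<theta> + snd \<theta> i + snd \<theta> j)))"
  by (simp add: neg_log_lik_def split: prod.split)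

lemma param_space_nonempty:
  assumes "0 < M\<^sub>1" "0 < M\<^sub>2"
  shows "param_space n M\<^sub>1 M\<^sub>2 s \<noteq> {}"
proof -
  have "(0, \<lambda>_. 0) \<in> param_space n M\<^sub>1 M\<^sub>2 s"
    using assms by (auto simp: param_space_def l0norm_def support_def)
  then show ?thesis by blast
qed

text \<open>
  Hoelder's inequality on the support: at most \<open>s\<close> summands are nonzero, so only the largest
  coefficient counts, multiplied by \<open>s\<close> rather than by \<open>n\<close>.
\<close>
lemma sparse_inner_product_le:
  assumes "\<theta> \<in> param_space n M\<^sub>1 M\<^sub>2 s" "0 \<le> M\<^sub>2" "0 \<le> b"
    and c: "\<And>i. i \<in> {1..n} \<Longrightarrow> \<bar>c i\<bar> \<le> b"
  shows "\<bar>\<Sum>i=1..n. c i * snd \<theta> i\<bar> \<le> M\<^sub>2 * real s * b"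
proof -
  obtain \<mu> \<beta> where \<theta>: "\<theta> = (\<mu>, \<beta>)" and \<beta>: "\<beta> \<in> {1..n} \<rightarrow> {0..M\<^sub>2}" and sparse: "l0norm n \<beta> \<le> s"
    using assms(1) by (auto simp: param_space_def)
  have "(\<Sum>i=1..n. c i * \<beta> i) = (\<Sum>i\<in>support n \<beta>. c i * \<beta> i)"
    by (rule sum.mono_neutral_right) (auto simp: support_def)
  then have "\<bar>\<Sum>i=1..n. c i * \<beta> i\<bar> \<le> (\<Sum>i\<in>support n \<beta>. \<bar>c i * \<beta> i\<bar>)"
    by simp
  also have "\<dots> \<le> (\<Sum>i\<in>support n \<beta>. b * M\<^sub>2)"
    using \<beta> c assms(2,3) by (intro sum_mono) (auto simp: support_def abs_mult Pi_iff intro!: mult_mono)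
  also have "\<dots> = real (l0norm n \<beta>) * (b * M\<^sub>2)"
    by (simp add: l0norm_def)
  also have "\<dots> \<le> real s * (b * M\<^sub>2)"
    using sparse assms(2,3) by (intro mult_right_mono) auto
  finally show ?thesis
    by (simp add: \<theta> mult_ac)
qed

context sparse_beta_model
begin

definition edge :: "nat \<times> nat \<Rightarrow> 'w \<Rightarrow> real" where
  "edge e \<omega> = of_bool (A \<omega> (fst e) (snd e))"

definition edge_mean :: "nat \<times> nat \<Rightarrow> real" where
  "edge_mean e = edge_prob \<mu>\<^sub>0 \<beta>\<^sub>0 (fst e) (snd e)"

lemma indep_vars_edge: "indep_vars (\<lambda>_. borel) edge (vertex_pairs n)"
proof -
  have "indep_vars (\<lambda>_. borel) (\<lambda>e \<omega>. of_bool ((\<lambda>(i, j) \<omega>. A \<omega> i j) e \<omega>) :: real) (vertex_pairs n)"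
    by (rule indep_vars_compose2[OF indep_edges]) auto
  then show ?thesis
    by (simp add: edge_def[abs_def] case_prod_beta)
qed

lemma random_variable_edge[measurable]:
  "e \<in> vertex_pairs n \<Longrightarrow> random_variable borel (edge e)"
  using indep_vars_edge by (auto simp: indep_vars_def)

lemma expectation_of_edge:
  fixes f :: "real \<Rightarrow> real"
  assumes e: "e \<in> vertex_pairs n"
  shows "expectation (\<lambda>\<omega>. f (edge e \<omega>)) = f 1 * edge_mean e + f 0 * (1 - edge_mean e)"
proof -
  obtain i j where ij: "e = (i, j)" by (cases e)
  have rv: "(\<lambda>\<omega>. A \<omega> i j) \<in> M \<rightarrow>\<^sub>M count_space UNIV"
    using indep_edges e by (auto simp: indep_vars_def ij)
  have "expectation (\<lambda>\<omega>. f (edge e \<omega>))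
      = (\<integral>b. f (of_bool b) \<partial>distr M (count_space UNIV) (\<lambda>\<omega>. A \<omega> i j))"
    using rv by (subst integral_distr) (auto simp: edge_def ij)
  also have "\<dots> = f 1 * edge_mean e + f 0 * (1 - edge_mean e)"
    unfolding bernoulli_edges[OF e[unfolded ij]]
    using edge_prob_bounds[of \<mu>\<^sub>0 \<beta>\<^sub>0 i j] by (simp add: edge_mean_def ij)
  finally show ?thesis .
qed

lemma edge_mean_bounds: "0 < edge_mean e" "edge_mean e < 1"
  by (simp_all add: edge_mean_def edge_prob_bounds)

lemma expectation_edge: "e \<in> vertex_pairs n \<Longrightarrow> expectation (edge e) = edge_mean e"
  using expectation_of_edge[of e "\<lambda>x. x"] by simp

lemma variance_edge: "e \<in> vertex_pairs n \<Longrightarrow> variance (edge e) = edge_mean e * (1 - edge_mean e)"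
  using expectation_of_edge[of e "\<lambda>x. (x - edge_mean e)\<^sup>2"]
  by (simp add: expectation_edge power2_eq_square algebra_simps)

lemma integrable_edge:
  assumes "e \<in> vertex_pairs n"
  shows "integrable M (edge e)" "integrable M (\<lambda>\<omega>. (edge e \<omega>)\<^sup>2)"
proof -
  have "\<bar>edge e \<omega>\<bar> \<le> 1" "\<bar>(edge e \<omega>)\<^sup>2\<bar> \<le> 1" for \<omega>
    by (simp_all add: edge_def)
  then show "integrable M (edge e)" "integrable M (\<lambda>\<omega>. (edge e \<omega>)\<^sup>2)"
    using random_variable_edge[OF assms] by (auto intro!: bounded_rv_integrable[where B = 1])
qed

lemma
  assumes "E \<subseteq> vertex_pairs n"
  shows expectation_edge_sum: "expectation (\<lambda>\<omega>. \<Sum>e\<in>E. edge e \<omega>) = (\<Sum>e\<in>E. edge_mean e)"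
    and variance_edge_sum:
      "variance (\<lambda>\<omega>. \<Sum>e\<in>E. edge e \<omega>) = (\<Sum>e\<in>E. edge_mean e * (1 - edge_mean e))"
proof -
  show "expectation (\<lambda>\<omega>. \<Sum>e\<in>E. edge e \<omega>) = (\<Sum>e\<in>E. edge_mean e)"
    using assms integrable_edge by (subst Bochner_Integration.integral_sum) (auto intro!: sum.cong simp: expectation_edge)
  have "variance (\<lambda>\<omega>. \<Sum>e\<in>E. edge e \<omega>) = (\<Sum>e\<in>E. variance (edge e))"
    using assms finite_subset[OF assms finite_vertex_pairs] integrable_edge
      indep_vars_subset[OF indep_vars_edge assms]
    by (intro variance_sum_indep[THEN conjunct1]) auto
  also have "\<dots> = (\<Sum>e\<in>E. edge_mean e * (1 - edge_mean e))"
    using assms by (intro sum.cong refl variance_edge) auto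
  finally show "variance (\<lambda>\<omega>. \<Sum>e\<in>E. edge e \<omega>) = (\<Sum>e\<in>E. edge_mean e * (1 - edge_mean e))" .
qed

text \<open>
  One statement serves the edge count and all degrees, which are the sums over \<open>vertex_pairs n\<close> and
  over \<open>incident_pairs n i\<close>. Edge probabilities strictly between 0 and 1 make the variance positive as
  soon as \<open>E\<close> is nonempty, as Bernstein's inequality requires.
\<close>
lemma edge_sum_concentration:
  assumes E: "E \<subseteq> vertex_pairs n" "E \<noteq> {}" and L: "0 < L"
  shows "prob {\<omega> \<in> space M.
      sqrt (2 * variance (\<lambda>\<omega>. \<Sum>e\<in>E. edge e \<omega>) * L) + L / 3
        \<le> \<bar>(\<Sum>e\<in>E. edge e \<omega>) - expectation (\<lambda>\<omega>. \<Sum>e\<in>E. edge e \<omega>)\<bar>} \<le> 2 * exp (- L)"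
proof -
  have fin: "finite E"
    using E finite_subset finite_vertex_pairs by blast
  define Y where "Y = (\<lambda>e \<omega>. edge e \<omega> - edge_mean e)"
  define V where "V = variance (\<lambda>\<omega>. \<Sum>e\<in>E. edge e \<omega>)"
  have "V = (\<Sum>e\<in>E. expectation (\<lambda>\<omega>. (Y e \<omega>)\<^sup>2))"
    unfolding V_def variance_edge_sum[OF E(1)]
    by (rule sum.cong) (use E variance_edge expectation_edge in \<open>auto simp: Y_def\<close>)
  moreover have "0 < V"
    unfolding V_def variance_edge_sum[OF E(1)] using E fin edge_mean_bounds by (intro sum_pos) auto
  moreover have "indep_vars (\<lambda>_. borel) Y E"
    unfolding Y_def by (rule indep_vars_compose2[OF indep_vars_subset[OF indep_vars_edge E(1)]]) auto
  moreover have "\<bar>Y e \<omega>\<bar> \<le> 1" for e \<omega>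
    using edge_mean_bounds[of e] by (auto simp: Y_def edge_def)
  moreover have "expectation (Y e) = 0" if "e \<in> E" for e
    using subsetD[OF E(1) that] by (simp add: Y_def expectation_edge integrable_edge prob_space)
  ultimately have "prob {\<omega> \<in> space M. sqrt (2 * V * L) + L / 3 \<le> \<bar>\<Sum>e\<in>E. Y e \<omega>\<bar>} \<le> 2 * exp (- L)"
    using L fin by (intro Bernstein_ineq_abs_ge)
  then show ?thesis
    by (simp add: V_def Y_def sum_subtractf expectation_edge_sum[OF E(1)])
qed

lemma num_edges_eq: "num_edges n (A \<omega>) = (\<Sum>e\<in>vertex_pairs n. edge e \<omega>)"
  by (simp add: num_edges_def edge_def case_prod_beta)

lemma vertex_degree_eq:
  assumes "\<omega> \<in> space M" "i \<in> {1..n}"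
  shows "vertex_degree n (A \<omega>) i = (\<Sum>e\<in>incident_pairs n i. edge e \<omega>)"
  unfolding vertex_degree_def edge_def
  by (rule sum_incident_pairs[symmetric]) (use assms symmetric in auto)

lemma expected_edges_eq: "expected_edges M n A = (\<Sum>e\<in>vertex_pairs n. edge_mean e)"
  by (simp add: expected_edges_def num_edges_eq expectation_edge_sum)

lemma variance_num_edges:
  "variance (\<lambda>\<omega>. num_edges n (A \<omega>)) = (\<Sum>e\<in>vertex_pairs n. edge_mean e * (1 - edge_mean e))"
  by (simp only: num_edges_eq variance_edge_sum[OF order_refl])

definition expected_degree :: "nat \<Rightarrow> real" where
  "expected_degree i = expectation (\<lambda>\<omega>. vertex_degree n (A \<omega>) i)"

lemma expected_degree_edge_sum:
  assumes "i \<in> {1..n}"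
  shows "expected_degree i = expectation (\<lambda>\<omega>. \<Sum>e\<in>incident_pairs n i. edge e \<omega>)"
  unfolding expected_degree_def
  by (rule Bochner_Integration.integral_cong) (use assms vertex_degree_eq in auto)

lemma variance_degree_edge_sum:
  assumes "i \<in> {1..n}"
  shows "variance (\<lambda>\<omega>. vertex_degree n (A \<omega>) i)
    = variance (\<lambda>\<omega>. \<Sum>e\<in>incident_pairs n i. edge e \<omega>)"
  unfolding expected_degree_def[symmetric] expected_degree_edge_sum[OF assms]
  by (rule Bochner_Integration.integral_cong) (use assms vertex_degree_eq in auto)

lemma expected_degree_eq:
  assumes "i \<in> {1..n}"
  shows "expected_degree i = (\<Sum>j\<in>{1..n} - {i}. edge_prob \<mu>\<^sub>0 \<beta>\<^sub>0 i j)"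
  unfolding expected_degree_edge_sum[OF assms] expectation_edge_sum[OF incident_pairs_subset]
    edge_mean_def
  by (rule sum_incident_pairs) (use assms edge_prob_commute in auto)

lemma variance_degree_le:
  assumes "i \<in> {1..n}"
  shows "variance (\<lambda>\<omega>. vertex_degree n (A \<omega>) i) \<le> expected_degree i"
  unfolding variance_degree_edge_sum[OF assms] variance_edge_sum[OF incident_pairs_subset]
  unfolding expected_degree_edge_sum[OF assms] expectation_edge_sum[OF incident_pairs_subset]
  by (rule sum_mono) (use edge_mean_bounds in \<open>auto intro!: mult_left_le less_imp_le\<close>)

lemma variance_num_edges_le: "variance (\<lambda>\<omega>. num_edges n (A \<omega>)) \<le> expected_edges M n A"
  unfolding variance_num_edges expected_edges_eq
  by (rule sum_mono) (use edge_mean_bounds in \<open>auto intro!: mult_left_le less_imp_le\<close>)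

lemma measurable_num_edges[measurable]: "random_variable borel (\<lambda>\<omega>. num_edges n (A \<omega>))"
  unfolding num_edges_eq by measurable

lemma measurable_edge_sum:
  "E \<subseteq> vertex_pairs n \<Longrightarrow> random_variable borel (\<lambda>\<omega>. \<Sum>e\<in>E. edge e \<omega>)"
  by (rule borel_measurable_sum) auto

lemma measurable_vertex_degree[measurable]:
  assumes "i \<in> {1..n}"
  shows "random_variable borel (\<lambda>\<omega>. vertex_degree n (A \<omega>) i)"
proof -
  have "random_variable borel (\<lambda>\<omega>. vertex_degree n (A \<omega>) i)
      \<longleftrightarrow> random_variable borel (\<lambda>\<omega>. \<Sum>e\<in>incident_pairs n i. edge e \<omega>)"
    by (rule measurable_cong) (use assms vertex_degree_eq in auto)
  then show ?thesis
    using measurable_edge_sum[OF incident_pairs_subset] by simp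
qed

lemma integrable_num_edges: "integrable M (\<lambda>\<omega>. num_edges n (A \<omega>))"
  unfolding num_edges_eq using integrable_edge by auto

lemma integrable_vertex_degree:
  assumes "i \<in> {1..n}"
  shows "integrable M (\<lambda>\<omega>. vertex_degree n (A \<omega>) i)"
proof -
  have "integrable M (\<lambda>\<omega>. \<Sum>e\<in>incident_pairs n i. edge e \<omega>)"
    using integrable_edge(1) subsetD[OF incident_pairs_subset]
    by (intro Bochner_Integration.integrable_sum) blast
  moreover have "integrable M (\<lambda>\<omega>. vertex_degree n (A \<omega>) i)
      \<longleftrightarrow> integrable M (\<lambda>\<omega>. \<Sum>e\<in>incident_pairs n i. edge e \<omega>)"
    by (rule Bochner_Integration.integrable_cong) (use assms vertex_degree_eq in auto)
  ultimately show ?thesis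
    by simp
qed

lemma risk_eq:
  "risk M n A \<theta> = inverse (expected_edges M n A) *
     (- expected_edges M n A * fst \<theta> - (\<Sum>i=1..n. expected_degree i * snd \<theta> i)
      + (\<Sum>(i, j)\<in>vertex_pairs n. ln (1 + exp (fst \<theta> + snd \<theta> i + snd \<theta> j))))"
proof -
  define C where "C = (\<Sum>(i, j)\<in>vertex_pairs n. ln (1 + exp (fst \<theta> + snd \<theta> i + snd \<theta> j)))"
  have int: "integrable M (\<lambda>\<omega>. \<Sum>i=1..n. vertex_degree n (A \<omega>) i * snd \<theta> i)"
    using integrable_vertex_degree by (intro Bochner_Integration.integrable_sum) auto
  have "expectation (\<lambda>\<omega>. \<Sum>i=1..n. vertex_degree n (A \<omega>) i * snd \<theta> i)
      = (\<Sum>i=1..n. expected_degree i * snd \<theta> i)"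
    using integrable_vertex_degree
    by (subst Bochner_Integration.integral_sum)
      (auto simp: expected_degree_def intro!: sum.cong integral_mult_left_zero)
  then have "expectation (\<lambda>\<omega>. neg_log_lik n (A \<omega>) \<theta>)
      = - expected_edges M n A * fst \<theta> - (\<Sum>i=1..n. expected_degree i * snd \<theta> i) + C"
    unfolding neg_log_lik_affine C_def[symmetric] expected_edges_def
    using int integrable_num_edges by (simp add: prob_space)
  then show ?thesis
    by (simp add: risk_def C_def)
qed

lemma expected_edges_pos:
  assumes "2 \<le> n"
  shows "0 < expected_edges M n A"
proof -
  have "vertex_pairs n \<noteq> {}"
    using first_pair_mem[OF assms] by blast
  then show ?thesis
    unfolding expected_edges_eq using finite_vertex_pairs edge_mean_bounds by (intro sum_pos) auto
qed

text \<open>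
  The logarithmic part of the likelihood is deterministic and cancels against its mean; what remains is
  linear in \<open>(\<mu>, \<beta>)\<close>. The right-hand side is the same for all parameters in the space, so that
  the bound may be applied at the random estimator.
\<close>
lemma neg_log_lik_deviation:
  assumes "2 \<le> n" and \<theta>: "\<theta> \<in> param_space n M\<^sub>1 M\<^sub>2 s" and "0 < M\<^sub>1" "0 < M\<^sub>2"
    and a: "\<bar>num_edges n (A \<omega>) - expected_edges M n A\<bar> \<le> a"
    and b: "0 \<le> b" "\<And>i. i \<in> {1..n} \<Longrightarrow> \<bar>vertex_degree n (A \<omega>) i - expected_degree i\<bar> \<le> b"
  shows "\<bar>neg_log_lik n (A \<omega>) \<theta> - expected_edges M n A * risk M n A \<theta>\<bar>
    \<le> M\<^sub>1 * a + M\<^sub>2 * real s * b"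
proof -
  define D where "D = expected_edges M n A"
  have D: "0 < D"
    using expected_edges_pos assms(1) by (simp add: D_def)
  have "D * risk M n A \<theta> = - D * fst \<theta> - (\<Sum>i=1..n. expected_degree i * snd \<theta> i)
      + (\<Sum>(i, j)\<in>vertex_pairs n. ln (1 + exp (fst \<theta> + snd \<theta> i + snd \<theta> j)))"
    unfolding risk_eq D_def[symmetric] using D by (simp only: mult.assoc[symmetric]) simp
  then have "neg_log_lik n (A \<omega>) \<theta> - D * risk M n A \<theta> = - ((num_edges n (A \<omega>) - D) * fst \<theta>)
      - (\<Sum>i=1..n. (vertex_degree n (A \<omega>) i - expected_degree i) * snd \<theta> i)"
    unfolding neg_log_lik_affine by (simp add: sum_subtractf left_diff_distrib)
  moreover have "\<bar>(num_edges n (A \<omega>) - D) * fst \<theta>\<bar> \<le> a * M\<^sub>1"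
    unfolding abs_mult using a \<theta> by (intro mult_mono) (auto simp: D_def param_space_def)
  moreover have "\<bar>\<Sum>i=1..n. (vertex_degree n (A \<omega>) i - expected_degree i) * snd \<theta> i\<bar>
      \<le> M\<^sub>2 * real s * b"
    by (rule sparse_inner_product_le[OF \<theta>]) (use assms in auto)
  ultimately show ?thesis
    by (simp add: D_def mult.commute)
qed

text \<open>
  The infimum of a set of reals is meaningful only if the set is bounded below. A crude bound
  suffices: the logarithms are nonnegative and the linear part is bounded on the parameter space.
\<close>
lemma bdd_below_risk:
  assumes "2 \<le> n" "0 < M\<^sub>1" "0 < M\<^sub>2"
  shows "bdd_below (risk M n A ` param_space n M\<^sub>1 M\<^sub>2 s)"
proof (rule bdd_belowI2)
  define D where "D = expected_edges M n A"
  have D: "0 < D"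
    using expected_edges_pos assms(1) by (simp add: D_def)
  fix \<theta> assume \<theta>: "\<theta> \<in> param_space n M\<^sub>1 M\<^sub>2 s"
  have "D * fst \<theta> \<le> D * M\<^sub>1"
    using \<theta> D by (intro mult_left_mono) (auto simp: param_space_def)
  moreover have "\<bar>\<Sum>i=1..n. expected_degree i * snd \<theta> i\<bar> \<le> M\<^sub>2 * real s * (\<Sum>i=1..n. \<bar>expected_degree i\<bar>)"
    by (rule sparse_inner_product_le[OF \<theta>])
      (use assms in \<open>auto intro!: sum_nonneg member_le_sum[of _ _ "\<lambda>i. \<bar>expected_degree i\<bar>"]\<close>)
  moreover have "0 \<le> (\<Sum>(i, j)\<in>vertex_pairs n. ln (1 + exp (fst \<theta> + snd \<theta> i + snd \<theta> j)))"
    by (intro sum_nonneg) (auto intro!: ln_ge_zero)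
  ultimately have "- D * M\<^sub>1 - M\<^sub>2 * real s * (\<Sum>i=1..n. \<bar>expected_degree i\<bar>)
      \<le> - D * fst \<theta> - (\<Sum>i=1..n. expected_degree i * snd \<theta> i)
        + (\<Sum>(i, j)\<in>vertex_pairs n. ln (1 + exp (fst \<theta> + snd \<theta> i + snd \<theta> j)))"
    by linarith
  then show "inverse D * (- D * M\<^sub>1 - M\<^sub>2 * real s * (\<Sum>i=1..n. \<bar>expected_degree i\<bar>)) \<le> risk M n A \<theta>"
    unfolding risk_eq D_def[symmetric] using D by (intro mult_left_mono) auto
qed

lemma excess_risk_nonneg:
  assumes "2 \<le> n" "0 < M\<^sub>1" "0 < M\<^sub>2" "constrained_mle M n A M\<^sub>1 M\<^sub>2 s \<theta>hat" "\<omega> \<in> space M"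
  shows "0 \<le> excess_risk M n A M\<^sub>1 M\<^sub>2 s \<theta>hat \<omega>"
proof -
  have "\<theta>hat \<omega> \<in> param_space n M\<^sub>1 M\<^sub>2 s"
    using assms(4,5) by (auto simp: constrained_mle_def is_arg_min_def)
  then show ?thesis
    unfolding excess_risk_def using cINF_lower[OF bdd_below_risk[OF assms(1-3)]] by fastforce
qed

text \<open>
  For every competitor \<open>\<theta>\<close> the risk of the estimator is replaced by its likelihood, then by the
  likelihood of \<open>\<theta>\<close>, then by the risk of \<open>\<theta>\<close>. The two exchanges of risk and likelihood each cost one
  deviation, and this is where the factor 2 comes from.
\<close>
lemma excess_risk_le:
  assumes "2 \<le> n" "0 < M\<^sub>1" "0 < M\<^sub>2" "constrained_mle M n A M\<^sub>1 M\<^sub>2 s \<theta>hat" "\<omega> \<in> space M"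
    and a: "\<bar>num_edges n (A \<omega>) - expected_edges M n A\<bar> \<le> a"
    and b: "0 \<le> b" "\<And>i. i \<in> {1..n} \<Longrightarrow> \<bar>vertex_degree n (A \<omega>) i - expected_degree i\<bar> \<le> b"
  shows "excess_risk M n A M\<^sub>1 M\<^sub>2 s \<theta>hat \<omega> \<le> 2 / expected_edges M n A * (M\<^sub>1 * a + M\<^sub>2 * real s * b)"
proof -
  define D where "D = expected_edges M n A"
  define B where "B = M\<^sub>1 * a + M\<^sub>2 * real s * b"
  have D: "0 < D"
    using expected_edges_pos assms(1) by (simp add: D_def)
  have hat: "\<theta>hat \<omega> \<in> param_space n M\<^sub>1 M\<^sub>2 s"
    using assms(4,5) by (simp add: constrained_mle_def is_arg_min_linorder)
  have minimal: "neg_log_lik n (A \<omega>) (\<theta>hat \<omega>) \<le> neg_log_lik n (A \<omega>) \<theta>"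
      if "\<theta> \<in> param_space n M\<^sub>1 M\<^sub>2 s" for \<theta>
    using assms(4,5) that unfolding constrained_mle_def is_arg_min_linorder by blast
  have dev: "\<bar>neg_log_lik n (A \<omega>) \<theta> - D * risk M n A \<theta>\<bar> \<le> B" if "\<theta> \<in> param_space n M\<^sub>1 M\<^sub>2 s" for \<theta>
    unfolding D_def B_def by (rule neg_log_lik_deviation) (use assms that in auto)
  have "risk M n A (\<theta>hat \<omega>) - 2 / D * B \<le> (INF \<theta>\<in>param_space n M\<^sub>1 M\<^sub>2 s. risk M n A \<theta>)"
  proof (rule cINF_greatest[OF param_space_nonempty])
    fix \<theta> assume \<theta>: "\<theta> \<in> param_space n M\<^sub>1 M\<^sub>2 s"
    have "D * risk M n A (\<theta>hat \<omega>) \<le> D * risk M n A \<theta> + 2 * B"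
      using dev[OF hat] dev[OF \<theta>] minimal[OF \<theta>] \<theta> by linarith
    then show "risk M n A (\<theta>hat \<omega>) - 2 / D * B \<le> risk M n A \<theta>"
      using D by (simp add: field_simps)
  qed (use assms in auto)
  then show ?thesis
    by (simp add: excess_risk_def D_def B_def)
qed

lemma excess_risk_measurable:
  assumes "constrained_mle M n A M\<^sub>1 M\<^sub>2 s \<theta>hat"
  shows "random_variable borel (excess_risk M n A M\<^sub>1 M\<^sub>2 s \<theta>hat)"
proof -
  have [measurable]: "(\<lambda>\<omega>. fst (\<theta>hat \<omega>)) \<in> borel_measurable M"
    using assms by (simp add: constrained_mle_def)
  have measurable_snd_hat[measurable]: "(\<lambda>\<omega>. snd (\<theta>hat \<omega>) i) \<in> borel_measurable M" if "i \<in> {1..n}" for i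
    using assms that by (auto simp: constrained_mle_def)
  have [measurable]: "(\<lambda>\<omega>. snd (\<theta>hat \<omega>) (fst e)) \<in> borel_measurable M"
      "(\<lambda>\<omega>. snd (\<theta>hat \<omega>) (snd e)) \<in> borel_measurable M" if "e \<in> vertex_pairs n" for e
    using that by (auto simp: vertex_pairs_def intro!: measurable_snd_hat)
  define D where "D = expected_edges M n A"
  define c where "c = (INF \<theta>\<in>param_space n M\<^sub>1 M\<^sub>2 s. risk M n A \<theta>)"
  have "random_variable borel (\<lambda>\<omega>. inverse D *
     (- D * fst (\<theta>hat \<omega>) - (\<Sum>i=1..n. expected_degree i * snd (\<theta>hat \<omega>) i)
      + (\<Sum>e\<in>vertex_pairs n. ln (1 + exp (fst (\<theta>hat \<omega>) + snd (\<theta>hat \<omega>) (fst e) + snd (\<theta>hat \<omega>) (snd e))))) - c)"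
    by measurable
  then show ?thesis
    by (simp add: excess_risk_def[abs_def] risk_eq[folded D_def] case_prod_beta flip: c_def)
qed

text \<open>
  With exponents \<open>ln (4 / \<tau>)\<close> and \<open>ln (4 n / \<tau>)\<close> the two-sided tails are \<open>\<tau> / 2\<close> for the edge count and
  \<open>\<tau> / (2 n)\<close> for each of the \<open>n\<close> degrees, which add up to \<open>\<tau>\<close>.
\<close>
theorem excess_risk_upper_bound:
  assumes "2 \<le> n" "0 < M\<^sub>1" "0 < M\<^sub>2" and mle: "constrained_mle M n A M\<^sub>1 M\<^sub>2 s \<theta>hat"
    and \<tau>: "0 < \<tau>" "\<tau> < 1"
  shows "1 - \<tau> \<le> prob {\<omega> \<in> space M. excess_risk M n A M\<^sub>1 M\<^sub>2 s \<theta>hat \<omega> \<le>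
          2 / expected_edges M n A *
            (M\<^sub>1 * (sqrt (2 * variance (\<lambda>\<omega>. num_edges n (A \<omega>)) * ln (4 / \<tau>)) + ln (4 / \<tau>) / 3)
             + M\<^sub>2 * real s *
                 (sqrt (2 * Max ((\<lambda>i. variance (\<lambda>\<omega>. vertex_degree n (A \<omega>) i)) ` {1..n})
                          * ln (4 * real n / \<tau>))
                     + ln (4 * real n / \<tau>) / 3))}"
    (is "_ \<le> prob ?good")
proof -
  define L where "L = ln (4 / \<tau>)"
  define L' where "L' = ln (4 * real n / \<tau>)"
  define vd where "vd = (\<lambda>i. variance (\<lambda>\<omega>. vertex_degree n (A \<omega>) i))"
  define a where "a = sqrt (2 * variance (\<lambda>\<omega>. num_edges n (A \<omega>)) * L) + L / 3"
  define b where "b = sqrt (2 * Max (vd ` {1..n}) * L') + L' / 3"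
  define B0 where "B0 = {\<omega> \<in> space M. a \<le> \<bar>num_edges n (A \<omega>) - expected_edges M n A\<bar>}"
  define B where "B = (\<lambda>i. {\<omega> \<in> space M.
    sqrt (2 * vd i * L') + L' / 3 \<le> \<bar>vertex_degree n (A \<omega>) i - expected_degree i\<bar>})"
  have L: "0 < L" "2 * exp (- L) = \<tau> / 2"
    using \<tau> by (simp_all add: L_def exp_minus)
  have L': "0 < L'" "2 * exp (- L') = \<tau> / (2 * real n)"
    using \<tau> assms(1) by (simp_all add: L'_def exp_minus)
  have "vertex_pairs n \<noteq> {}"
    using first_pair_mem[OF assms(1)] by blast
  then have P0: "prob B0 \<le> \<tau> / 2"
    using edge_sum_concentration[OF order_refl _ L(1)]
    by (simp add: B0_def a_def num_edges_eq expected_edges_def L(2))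
  have PB: "prob (B i) \<le> \<tau> / (2 * real n)" if i: "i \<in> {1..n}" for i
  proof -
    have "incident_pairs n i \<noteq> {}"
    proof (cases "i = 1")
      case True
      then show ?thesis
        using first_pair_mem[OF assms(1)] by (auto simp: incident_pairs_def)
    next
      case False
      then have "(1, i) \<in> incident_pairs n i"
        using i by (auto simp: incident_pairs_def vertex_pairs_def)
      then show ?thesis
        by blast
    qed
    note conc = edge_sum_concentration[OF incident_pairs_subset this L'(1)]
    have "B i = {\<omega> \<in> space M. sqrt (2 * vd i * L') + L' / 3
        \<le> \<bar>(\<Sum>e\<in>incident_pairs n i. edge e \<omega>) - expected_degree i\<bar>}"
      using vertex_degree_eq[OF _ i] by (auto simp: B_def)
    then show ?thesis
      using conc unfolding vd_def variance_degree_edge_sum[OF i] expected_degree_edge_sum[OF i] L'(2)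
      by simp
  qed
  have [measurable]: "B0 \<in> events" "i \<in> {1..n} \<Longrightarrow> B i \<in> events" for i
    unfolding B0_def B_def by measurable
  have good_event[measurable]: "?good \<in> events"
    using excess_risk_measurable[OF mle] by measurable
  \<comment> \<open>The largest degree variance gives one threshold that works for all vertices.\<close>
  have b: "sqrt (2 * vd i * L') + L' / 3 \<le> b" if "i \<in> {1..n}" for i
    using that L'(1) by (auto simp: b_def intro!: mult_right_mono)
  have "0 \<le> vd 1"
    unfolding vd_def by (rule variance_positive)
  then have b0: "0 \<le> b"
    using b[of 1] L'(1) assms(1) by (intro order.trans[OF _ b[of 1]]) auto
  have "space M - ?good \<subseteq> B0 \<union> (\<Union>i\<in>{1..n}. B i)"
  proof (rule subsetI, rule ccontr)
    fix \<omega> assume \<omega>: "\<omega> \<in> space M - ?good" "\<omega> \<notin> B0 \<union> (\<Union>i\<in>{1..n}. B i)"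
    then have "\<bar>num_edges n (A \<omega>) - expected_edges M n A\<bar> \<le> a"
      by (auto simp: B0_def)
    moreover have "\<bar>vertex_degree n (A \<omega>) i - expected_degree i\<bar> \<le> b" if "i \<in> {1..n}" for i
      using \<omega> b[OF that] that by (force simp: B_def)
    ultimately have "excess_risk M n A M\<^sub>1 M\<^sub>2 s \<theta>hat \<omega>
        \<le> 2 / expected_edges M n A * (M\<^sub>1 * a + M\<^sub>2 * real s * b)"
      using assms \<omega> b0 by (intro excess_risk_le) auto
    then show False
      using \<omega>(1) by (simp add: a_def b_def vd_def L_def L'_def)
  qed
  then have "prob (space M - ?good) \<le> prob (B0 \<union> (\<Union>i\<in>{1..n}. B i))"
    by (intro finite_measure_mono) auto
  also have "\<dots> \<le> prob B0 + prob (\<Union>i\<in>{1..n}. B i)"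
    by (intro measure_Un_le) auto
  also have "\<dots> \<le> prob B0 + (\<Sum>i\<in>{1..n}. prob (B i))"
    by (intro add_left_mono measure_UNION_le) auto
  also have "\<dots> \<le> \<tau> / 2 + (\<Sum>i\<in>{1..n}. \<tau> / (2 * real n))"
    by (intro add_mono P0 sum_mono PB)
  also have "\<dots> = \<tau>"
    using assms(1) by simp
  finally show ?thesis
    using prob_compl[OF good_event] by simp
qed

end

section \<open>Orders of magnitude and the rate of the excess risk\<close>

lemma card_vertex_pairs: "2 * card (vertex_pairs n) = n * (n - 1)"
proof (induction n)
  case 0
  have "vertex_pairs 0 = {}"
    by (auto simp: vertex_pairs_def)
  then show ?case by simp
next
  case (Suc n)
  have "vertex_pairs (Suc n) = vertex_pairs n \<union> (\<lambda>i. (i, Suc n)) ` {1..n}"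
    by (auto simp: vertex_pairs_def)
  moreover have "card ((\<lambda>i. (i, Suc n)) ` {1..n}) = n"
    by (subst card_image) (auto simp: inj_on_def)
  moreover have "vertex_pairs n \<inter> (\<lambda>i. (i, Suc n)) ` {1..n} = {}"
    by (auto simp: vertex_pairs_def)
  ultimately have "card (vertex_pairs (Suc n)) = card (vertex_pairs n) + n"
    using finite_vertex_pairs by (simp add: card_Un_disjoint)
  then show ?case
    using Suc.IH by (cases n) (auto simp: algebra_simps)
qed

lemma card_vertex_pairs_ge:
  assumes "2 \<le> n"
  shows "(real n)\<^sup>2 / 4 \<le> real (card (vertex_pairs n))"
proof -
  have "real n * real n \<le> real n * (2 * (real n - 1))"
    using assms by (intro mult_left_mono) auto
  also have "\<dots> = 4 * real (card (vertex_pairs n))"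
    using arg_cong[OF card_vertex_pairs[of n], of real] assms
    by (simp add: of_nat_diff) (simp add: algebra_simps)
  finally show ?thesis
    by (simp add: power2_eq_square)
qed

lemma edge_prob_le: "edge_prob \<mu> \<beta> i j \<le> exp \<mu> * exp (\<beta> i) * exp (\<beta> j)"
proof -
  have "edge_prob \<mu> \<beta> i j \<le> exp (\<mu> + \<beta> i + \<beta> j)"
    unfolding edge_prob_def by (simp add: divide_le_eq add_pos_pos algebra_simps)
  then show ?thesis
    by (simp add: exp_add)
qed

text \<open>
  The logistic function is increasing, so nonnegative \<open>\<beta>\<close> only raises the probability above its value at
  \<open>\<beta> = 0\<close>; the denominator there is controlled by an upper bound on \<open>e\<^sup>\<mu>\<close>.
\<close>
lemma edge_prob_ge:
  assumes "0 \<le> \<beta> i" "0 \<le> \<beta> j" "exp \<mu> \<le> K"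
  shows "exp \<mu> / (1 + K) \<le> edge_prob \<mu> \<beta> i j"
proof -
  define x where "x = exp (\<mu> + \<beta> i + \<beta> j)"
  have x: "exp \<mu> \<le> x"
    using assms by (simp add: x_def)
  have "exp \<mu> / (1 + K) \<le> exp \<mu> / (1 + exp \<mu>)"
    using assms by (intro divide_left_mono) (auto simp: add_pos_pos intro!: mult_pos_pos add_pos_pos less_le_trans[OF exp_gt_zero assms(3)])
  also have "\<dots> \<le> x / (1 + x)"
    using x exp_gt_zero[of \<mu>] by (simp add: field_simps add_pos_pos less_le_trans[OF exp_gt_zero x])
  finally show ?thesis
    by (simp add: edge_prob_def x_def)
qed

context sparse_beta_model
begin

text \<open>
  The assumptions on the order of growth, at a fixed \<open>n\<close> and with an explicit constant \<open>C\<close>. The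
  constants in the bounds derived from them depend on \<open>C\<close> but not on \<open>n\<close>.
\<close>
context
  fixes \<gamma> \<alpha> C :: real
  assumes \<gamma>: "0 \<le> \<gamma>" and \<alpha>: "0 \<le> \<alpha>" and n2: "2 \<le> n" and C: "0 \<le> C"
    and \<mu>: "\<bar>\<mu>\<^sub>0 + \<gamma> * ln (real n)\<bar> \<le> C"
    and \<beta>: "\<And>i. i \<in> support n \<beta>\<^sub>0 \<Longrightarrow> \<bar>\<beta>\<^sub>0 i - \<alpha> * ln (real n)\<bar> \<le> C"
    and sparse: "real (l0norm n \<beta>\<^sub>0) \<le> real n powr (1 - \<alpha>)"
begin

lemma exp_beta_le:
  assumes "i \<in> {1..n}"
  shows "exp (\<beta>\<^sub>0 i) \<le> exp C * real n powr \<alpha>"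
proof -
  have "\<beta>\<^sub>0 i \<le> C + \<alpha> * ln (real n)"
  proof (cases "i \<in> support n \<beta>\<^sub>0")
    case False
    then show ?thesis
      using assms C \<alpha> n2 by (auto simp: support_def intro!: add_nonneg_nonneg mult_nonneg_nonneg)
  qed (use \<beta> in force)
  then have "exp (\<beta>\<^sub>0 i) \<le> exp (C + \<alpha> * ln (real n))"
    by simp
  then show ?thesis
    using n2 by (simp add: exp_add powr_def)
qed

text \<open>
  This is where sparsity is needed: the vertices off the support contribute at most \<open>n\<close>, and the at most
  \<open>n\<^bsup>1-\<alpha>\<^esup>\<close> others have weight at most \<open>e\<^sup>C n\<^sup>\<alpha>\<close> each, so together they also contribute only \<open>O(n)\<close>.
\<close>
lemma sum_exp_beta_le: "(\<Sum>i=1..n. exp (\<beta>\<^sub>0 i)) \<le> (1 + exp C) * real n"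
proof -
  have "(\<Sum>i=1..n. exp (\<beta>\<^sub>0 i)) \<le> (\<Sum>i=1..n. 1 + (if i \<in> support n \<beta>\<^sub>0 then exp C * real n powr \<alpha> else 0))"
  proof (rule sum_mono)
    fix i assume "i \<in> {1..n}"
    then show "exp (\<beta>\<^sub>0 i) \<le> 1 + (if i \<in> support n \<beta>\<^sub>0 then exp C * real n powr \<alpha> else 0)"
      using exp_beta_le[of i] by (cases "i \<in> support n \<beta>\<^sub>0") (auto simp: support_def)
  qed
  also have "\<dots> = real n + real (l0norm n \<beta>\<^sub>0) * (exp C * real n powr \<alpha>)"
  proof -
    have "{1..n} \<inter> {i. i \<in> support n \<beta>\<^sub>0} = support n \<beta>\<^sub>0"
      by (auto simp: support_def)
    then show ?thesis
      by (simp add: sum.distrib l0norm_def flip: sum.inter_restrict)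
  qed
  also have "\<dots> \<le> real n + real n powr (1 - \<alpha>) * (exp C * real n powr \<alpha>)"
    using sparse by (intro add_left_mono mult_right_mono) auto
  also have "real n powr (1 - \<alpha>) * (exp C * real n powr \<alpha>) = exp C * real n"
    using n2 by (simp add: powr_diff)
  finally show ?thesis
    by (simp add: algebra_simps)
qed

lemma exp_mu_bounds:
  "exp \<mu>\<^sub>0 \<le> exp C * real n powr (- \<gamma>)" "exp (- C) * real n powr (- \<gamma>) \<le> exp \<mu>\<^sub>0" "exp \<mu>\<^sub>0 \<le> exp C"
proof -
  have eq: "exp c * real n powr (- \<gamma>) = exp (c - \<gamma> * ln (real n))" for c
    using n2 by (simp add: powr_def exp_diff exp_minus field_simps)
  show "exp \<mu>\<^sub>0 \<le> exp C * real n powr (- \<gamma>)" "exp (- C) * real n powr (- \<gamma>) \<le> exp \<mu>\<^sub>0"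
    unfolding eq using \<mu> by simp_all
  have "0 \<le> \<gamma> * ln (real n)"
    using \<gamma> n2 by simp
  then show "exp \<mu>\<^sub>0 \<le> exp C"
    using \<mu> by simp
qed

lemma expected_edges_upper:
  "expected_edges M n A \<le> exp C * (1 + exp C)\<^sup>2 * real n powr (2 - \<gamma>)"
proof -
  let ?w = "\<lambda>i. exp (\<beta>\<^sub>0 i)"
  have "expected_edges M n A \<le> (\<Sum>(i, j)\<in>vertex_pairs n. exp \<mu>\<^sub>0 * ?w i * ?w j)"
    unfolding expected_edges_eq by (intro sum_mono) (auto simp: edge_mean_def edge_prob_le)
  also have "\<dots> \<le> (\<Sum>(i, j)\<in>{1..n} \<times> {1..n}. exp \<mu>\<^sub>0 * ?w i * ?w j)"
    by (intro sum_mono2) (auto simp: vertex_pairs_def)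
  also have "\<dots> = exp \<mu>\<^sub>0 * (\<Sum>i=1..n. ?w i)\<^sup>2"
    by (simp add: sum.cartesian_product[symmetric] power2_eq_square sum_product sum_distrib_left mult_ac)
  also have "\<dots> \<le> (exp C * real n powr (- \<gamma>)) * ((1 + exp C) * real n)\<^sup>2"
    using exp_mu_bounds sum_exp_beta_le by (intro mult_mono power_mono sum_nonneg) auto
  also have "\<dots> = exp C * (1 + exp C)\<^sup>2 * real n powr (2 - \<gamma>)"
  proof -
    have "real n powr (- \<gamma>) * (real n)\<^sup>2 = real n powr (2 - \<gamma>)"
      using n2 by (simp add: powr_diff powr_minus divide_inverse)
    then show ?thesis
      by (simp add: power_mult_distrib mult_ac)
  qed
  finally show ?thesis .
qed

lemma expected_edges_lower:
  "exp (- C) / (4 * (1 + exp C)) * real n powr (2 - \<gamma>) \<le> expected_edges M n A"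
proof -
  define q where "q = exp (- C) * real n powr (- \<gamma>) / (1 + exp C)"
  have "0 < 1 + exp C"
    by (simp add: add_pos_pos)
  then have q: "0 \<le> q"
    by (simp add: q_def)
  have "exp (- C) / (4 * (1 + exp C)) * real n powr (2 - \<gamma>) = (real n)\<^sup>2 / 4 * q"
    using n2 by (simp add: q_def powr_diff powr_minus field_simps)
  also have "\<dots> \<le> real (card (vertex_pairs n)) * q"
    using card_vertex_pairs_ge[OF n2] q by (intro mult_right_mono)
  also have "\<dots> = (\<Sum>e\<in>vertex_pairs n. q)"
    by simp
  also have "\<dots> \<le> (\<Sum>e\<in>vertex_pairs n. edge_mean e)"
  proof (rule sum_mono)
    fix e assume "e \<in> vertex_pairs n"
    then have "exp \<mu>\<^sub>0 / (1 + exp C) \<le> edge_mean e"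
      unfolding edge_mean_def using exp_mu_bounds(3)
      by (intro edge_prob_ge beta0_nonneg) (auto simp: vertex_pairs_def)
    moreover have "q \<le> exp \<mu>\<^sub>0 / (1 + exp C)"
      unfolding q_def using exp_mu_bounds(2) \<open>0 < 1 + exp C\<close> by (intro divide_right_mono) auto
    ultimately show "q \<le> edge_mean e"
      by linarith
  qed
  finally show ?thesis
    by (simp add: expected_edges_eq)
qed

text \<open>
  Off the support the weight of the vertex itself is 1, and the same estimate would give order
  \<open>n\<^bsup>1-\<gamma>\<^esup>\<close>; a vertex of the support costs another factor \<open>n\<^sup>\<alpha>\<close>, which is the source of \<open>\<alpha>\<close> in
  the rate.
\<close>
lemma expected_degree_upper:
  assumes i: "i \<in> {1..n}"
  shows "expected_degree i \<le> (exp C)\<^sup>2 * (1 + exp C) * real n powr (1 - \<gamma> + \<alpha>)"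
proof -
  let ?w = "\<lambda>i. exp (\<beta>\<^sub>0 i)"
  have "expected_degree i \<le> (\<Sum>j\<in>{1..n} - {i}. exp \<mu>\<^sub>0 * ?w i * ?w j)"
    unfolding expected_degree_eq[OF i] by (intro sum_mono edge_prob_le)
  also have "\<dots> \<le> (\<Sum>j=1..n. exp \<mu>\<^sub>0 * ?w i * ?w j)"
    by (intro sum_mono2) auto
  also have "\<dots> = exp \<mu>\<^sub>0 * ?w i * (\<Sum>j=1..n. ?w j)"
    by (simp add: sum_distrib_left)
  also have "\<dots> \<le> (exp C * real n powr (- \<gamma>)) * (exp C * real n powr \<alpha>) * ((1 + exp C) * real n)"
    using exp_mu_bounds sum_exp_beta_le exp_beta_le[OF i]
    by (intro mult_mono sum_nonneg mult_nonneg_nonneg) auto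
  also have "\<dots> = (exp C)\<^sup>2 * (1 + exp C) * real n powr (1 - \<gamma> + \<alpha>)"
    using n2 by (simp add: powr_diff powr_add powr_minus power2_eq_square field_simps)
  finally show ?thesis .
qed

end

end

text \<open>
  Inserts the orders of \<open>D\<^sub>+\<close> and of the variances (\<open>V\<close> for the edge count, \<open>W\<close> for the degrees) into
  the bound of \<open>excess_risk_upper_bound\<close>, with \<open>m\<^sub>1 = M\<^sub>1\<close>, \<open>m\<^sub>2 = M\<^sub>2 s\<close> and \<open>L = ln (4 / \<tau>)\<close>, so that
  \<open>ln (4 n / \<tau>) = L + ln n\<close>. The summands without a square root are absorbed: \<open>L / 3\<close> because
  \<open>N powr (1 - \<gamma> / 2) \<ge> 1\<close>, and the one of order \<open>ln N\<close> because \<open>ln N \<le> N powr e / e\<close>. The latter is the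
  reason for requiring \<open>\<gamma> - \<alpha> < 1\<close>.
\<close>
lemma excess_bound_le_rate:
  fixes N D V W c C\<^sub>1 C\<^sub>2 L \<gamma> \<alpha> m\<^sub>1 m\<^sub>2 :: real
  defines "e \<equiv> 1 - \<gamma> + \<alpha>" and "q \<equiv> L / ln 2 + 1"
  assumes N: "2 \<le> N" and \<gamma>: "\<gamma> < 2" and e: "0 < e" and L: "0 < L"
    and c: "0 < c" and C: "0 \<le> C\<^sub>1" "0 \<le> C\<^sub>2" and m: "0 \<le> m\<^sub>1" "0 \<le> m\<^sub>2"
    and D: "c * N powr (2 - \<gamma>) \<le> D"
    and V: "V \<le> C\<^sub>1 * N powr (2 - \<gamma>)"
    and W: "W \<le> C\<^sub>2 * N powr e"
  shows "2 / D * (m\<^sub>1 * (sqrt (2 * V * L) + L / 3) + m\<^sub>2 * (sqrt (2 * W * (L + ln N)) + (L + ln N) / 3))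
    \<le> 2 / c * ((sqrt (2 * C\<^sub>1 * L) + L / 3) + (sqrt (2 * C\<^sub>2 * q) + q / 3 * sqrt (1 / e)))
        * (m\<^sub>1 / N powr (1 - \<gamma> / 2) + m\<^sub>2 * sqrt (ln N) / N powr (3 / 2 - (\<gamma> + \<alpha>) / 2))"
proof -
  define T\<^sub>1 where "T\<^sub>1 = sqrt (2 * C\<^sub>1 * L) + L / 3"
  define T\<^sub>2 where "T\<^sub>2 = sqrt (2 * C\<^sub>2 * q) + q / 3 * sqrt (1 / e)"
  have lnN: "0 < ln N"
    using N by simp
  have q: "0 < q"
    using L by (simp add: q_def add_pos_pos)
  have T: "0 \<le> T\<^sub>1" "0 \<le> T\<^sub>2"
    using C L q e by (simp_all add: T\<^sub>1_def T\<^sub>2_def)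
  have sqrt_powr: "sqrt (N powr x) = N powr (x / 2)" for x
    using N by (simp add: powr_half_sqrt[symmetric] powr_powr)
  \<comment> \<open>From \<open>2 \<le> N\<close>; the constant \<open>q\<close> absorbs \<open>L\<close> into a multiple of \<open>ln N\<close>.\<close>
  have "L \<le> L / ln 2 * ln N"
    using N L by (simp add: field_simps)
  then have log_le: "L + ln N \<le> q * ln N"
    by (simp add: q_def algebra_simps)
  have first: "sqrt (2 * V * L) + L / 3 \<le> T\<^sub>1 * N powr (1 - \<gamma> / 2)"
  proof -
    have "2 * V * L \<le> 2 * C\<^sub>1 * L * N powr (2 - \<gamma>)"
      using mult_right_mono[OF V, of "2 * L"] L by (simp add: mult_ac)
    then have "sqrt (2 * V * L) \<le> sqrt (2 * C\<^sub>1 * L * N powr (2 - \<gamma>))"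
      by simp
    also have "\<dots> = sqrt (2 * C\<^sub>1 * L) * N powr (1 - \<gamma> / 2)"
      unfolding real_sqrt_mult[of "2 * C\<^sub>1 * L"] sqrt_powr by (simp add: diff_divide_distrib)
    finally have "sqrt (2 * V * L) \<le> sqrt (2 * C\<^sub>1 * L) * N powr (1 - \<gamma> / 2)" .
    moreover have "1 \<le> N powr (1 - \<gamma> / 2)"
      using N \<gamma> by (intro ge_one_powr_ge_zero) auto
    then have "L / 3 * 1 \<le> L / 3 * N powr (1 - \<gamma> / 2)"
      using L by (intro mult_left_mono) auto
    ultimately show ?thesis
      by (simp add: T\<^sub>1_def distrib_right)
  qed
  have second: "sqrt (2 * W * (L + ln N)) + (L + ln N) / 3 \<le> T\<^sub>2 * (sqrt (ln N) * N powr (e / 2))"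
  proof -
    have "2 * W * (L + ln N) \<le> 2 * (C\<^sub>2 * N powr e) * (L + ln N)"
      using W L lnN by (intro mult_right_mono) auto
    also have "\<dots> \<le> 2 * (C\<^sub>2 * N powr e) * (q * ln N)"
      using log_le C by (intro mult_left_mono) auto
    finally have "sqrt (2 * W * (L + ln N)) \<le> sqrt (2 * C\<^sub>2 * q * (ln N * N powr e))"
      by (simp add: mult_ac)
    also have "\<dots> = sqrt (2 * C\<^sub>2 * q) * (sqrt (ln N) * N powr (e / 2))"
      unfolding real_sqrt_mult[of "2 * C\<^sub>2 * q"] real_sqrt_mult[of "ln N"] sqrt_powr ..
    finally have main: "sqrt (2 * W * (L + ln N)) \<le> sqrt (2 * C\<^sub>2 * q) * (sqrt (ln N) * N powr (e / 2))" .
    have "ln N \<le> 1 / e * N powr e"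
      using ln_powr_bound[of N e] N e by simp
    then have "sqrt (ln N) \<le> sqrt (1 / e * N powr e)"
      by simp
    also have "\<dots> = sqrt (1 / e) * N powr (e / 2)"
      unfolding real_sqrt_mult[of "1 / e"] sqrt_powr ..
    finally have "sqrt (ln N) * sqrt (ln N) \<le> sqrt (ln N) * (sqrt (1 / e) * N powr (e / 2))"
      using lnN by (intro mult_left_mono) auto
    then have "q / 3 * ln N \<le> q / 3 * (sqrt (ln N) * (sqrt (1 / e) * N powr (e / 2)))"
      using lnN q by (intro mult_left_mono) auto
    moreover have "(L + ln N) / 3 \<le> q / 3 * ln N"
      using log_le by simp
    ultimately have "(L + ln N) / 3 \<le> q / 3 * sqrt (1 / e) * (sqrt (ln N) * N powr (e / 2))"
      by (simp only: mult_ac)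
    with main show ?thesis
      unfolding T\<^sub>2_def distrib_right by linarith
  qed
  define B where "B = m\<^sub>1 * (sqrt (2 * V * L) + L / 3) + m\<^sub>2 * (sqrt (2 * W * (L + ln N)) + (L + ln N) / 3)"
  define B' where "B' = m\<^sub>1 * (T\<^sub>1 * N powr (1 - \<gamma> / 2)) + m\<^sub>2 * (T\<^sub>2 * (sqrt (ln N) * N powr (e / 2)))"
  have "B \<le> B'"
    unfolding B_def B'_def using first second m by (intro add_mono mult_left_mono)
  have "0 \<le> B'"
    unfolding B'_def using m T lnN by (intro add_nonneg_nonneg mult_nonneg_nonneg) auto
  have cN: "0 < c * N powr (2 - \<gamma>)"
    using c N by simp
  have factor_out: "2 / c * (t * (m\<^sub>1 * (1 / x)) + t * (m\<^sub>2 * r * (1 / y)))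
      = 2 / c * t * (m\<^sub>1 / x + m\<^sub>2 * r / y)" for t x y r
    by (simp add: distrib_left)
  have "2 / D * B \<le> 2 / D * B'"
    using \<open>B \<le> B'\<close> D cN by (intro mult_left_mono) auto
  also have "\<dots> \<le> 2 / (c * N powr (2 - \<gamma>)) * B'"
    using D cN \<open>0 \<le> B'\<close> by (intro mult_right_mono divide_left_mono mult_pos_pos[of D]) auto
  also have "\<dots> = 2 / c * (T\<^sub>1 * (m\<^sub>1 * (N powr (1 - \<gamma> / 2) / N powr (2 - \<gamma>)))
      + T\<^sub>2 * (m\<^sub>2 * sqrt (ln N) * (N powr (e / 2) / N powr (2 - \<gamma>))))"
    using c by (simp add: B'_def divide_simps)
  also have "N powr (1 - \<gamma> / 2) / N powr (2 - \<gamma>) = 1 / N powr (1 - \<gamma> / 2)"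
    by (simp add: powr_minus_divide[symmetric] flip: powr_diff)
  also have "N powr (e / 2) / N powr (2 - \<gamma>) = 1 / N powr (3 / 2 - (\<gamma> + \<alpha>) / 2)"
  proof -
    have "e / 2 - (2 - \<gamma>) = - (3 / 2 - (\<gamma> + \<alpha>) / 2)"
      by (simp add: e_def field_simps)
    then show ?thesis
      by (simp only: powr_diff[symmetric] powr_minus_divide)
  qed
  also have "2 / c * (T\<^sub>1 * (m\<^sub>1 * (1 / N powr (1 - \<gamma> / 2)))
      + T\<^sub>2 * (m\<^sub>2 * sqrt (ln N) * (1 / N powr (3 / 2 - (\<gamma> + \<alpha>) / 2))))
      \<le> 2 / c * ((T\<^sub>1 + T\<^sub>2) * (m\<^sub>1 * (1 / N powr (1 - \<gamma> / 2)))
      + (T\<^sub>1 + T\<^sub>2) * (m\<^sub>2 * sqrt (ln N) * (1 / N powr (3 / 2 - (\<gamma> + \<alpha>) / 2))))"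
    using c m T lnN by (intro mult_left_mono add_mono mult_right_mono) auto
  also have "\<dots> = 2 / c * (T\<^sub>1 + T\<^sub>2)
      * (m\<^sub>1 / N powr (1 - \<gamma> / 2) + m\<^sub>2 * sqrt (ln N) / N powr (3 / 2 - (\<gamma> + \<alpha>) / 2))"
    by (rule factor_out)
  finally show ?thesis
    by (simp add: B_def T\<^sub>1_def T\<^sub>2_def)
qed

lemma same_orderI:
  assumes "0 < c" "\<forall>\<^sub>F n in sequentially. 0 < b n"
    and "\<forall>\<^sub>F n in sequentially. c * b n \<le> a n" "\<forall>\<^sub>F n in sequentially. a n \<le> C * b n"
  shows "same_order a b"
proof -
  have "\<forall>\<^sub>F n in sequentially. ereal c \<le> ereal (a n / b n)"
    using assms(2,3) by eventually_elim (simp add: pos_le_divide_eq)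
  then have "ereal c \<le> liminf (\<lambda>n. ereal (a n / b n))"
    by (rule Liminf_bounded)
  moreover have "\<forall>\<^sub>F n in sequentially. ereal (a n / b n) \<le> ereal C"
    using assms(2,4) by eventually_elim (simp add: pos_divide_le_eq)
  then have "limsup (\<lambda>n. ereal (a n / b n)) \<le> ereal C"
    by (rule Limsup_bounded)
  ultimately show ?thesis
    using assms(1) by (auto simp: same_order_def intro: less_le_trans[of _ "ereal c"] le_less_trans[of _ "ereal C"])
qed

text \<open>
  It is enough to consider failure probabilities below 1, because the probability bound becomes weaker
  as \<open>\<epsilon>\<close> grows.
\<close>
lemma bigO_in_probI:
  assumes "\<And>\<tau>. 0 < \<tau> \<Longrightarrow> \<tau> < 1 \<Longrightarrow> \<exists>K>0. \<forall>\<^sub>F n in sequentially.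
    1 - \<tau> \<le> measure (M n) {\<omega> \<in> space (M n). \<bar>X n \<omega>\<bar> \<le> K * a n}"
  shows "bigO_in_prob M X a"
  unfolding bigO_in_prob_def
proof (intro allI impI)
  fix \<epsilon> :: real assume "0 < \<epsilon>"
  then have "0 < min \<epsilon> (1 / 2)" "min \<epsilon> (1 / 2) < 1"
    by auto
  from assms[OF this] obtain K where K: "0 < K" "\<forall>\<^sub>F n in sequentially.
      1 - min \<epsilon> (1 / 2) \<le> measure (M n) {\<omega> \<in> space (M n). \<bar>X n \<omega>\<bar> \<le> K * a n}"
    by blast
  from K(2) have "\<forall>\<^sub>F n in sequentially. 1 - \<epsilon> \<le> measure (M n) {\<omega> \<in> space (M n). \<bar>X n \<omega>\<bar> \<le> K * a n}"
    by eventually_elim auto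
  with K(1) show "\<exists>K>0. \<forall>\<^sub>F n in sequentially.
      1 - \<epsilon> \<le> measure (M n) {\<omega> \<in> space (M n). \<bar>X n \<omega>\<bar> \<le> K * a n}"
    by blast
qed

text \<open>
  One constant \<open>C\<close> serves both \<open>O(1)\<close> terms, so that the bounds at fixed \<open>n\<close> hold for all large \<open>n\<close>
  with the same constants.
\<close>
locale sparse_regime =
  fixes M :: "nat \<Rightarrow> 'w measure" and A :: "nat \<Rightarrow> 'w \<Rightarrow> nat \<Rightarrow> nat \<Rightarrow> bool"
    and \<mu>\<^sub>0 :: "nat \<Rightarrow> real" and \<beta>\<^sub>0 :: "nat \<Rightarrow> nat \<Rightarrow> real" and \<gamma> \<alpha> C :: real
  assumes model: "\<And>n. 2 \<le> n \<Longrightarrow> sparse_beta_model (M n) n (A n) (\<mu>\<^sub>0 n) (\<beta>\<^sub>0 n)"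
    and exponents: "0 \<le> \<gamma>" "\<gamma> < 2" "0 \<le> \<alpha>" "\<gamma> - \<alpha> < 1"
    and C_nonneg: "0 \<le> C"
    and regime: "\<forall>\<^sub>F n in sequentially. 2 \<le> n \<and> \<bar>\<mu>\<^sub>0 n + \<gamma> * ln (real n)\<bar> \<le> C
      \<and> (\<forall>i\<in>support n (\<beta>\<^sub>0 n). \<bar>\<beta>\<^sub>0 n i - \<alpha> * ln (real n)\<bar> \<le> C)
      \<and> real (l0norm n (\<beta>\<^sub>0 n)) \<le> real n powr (1 - \<alpha>)"
begin

lemma eventually_bounds:
  "\<forall>\<^sub>F n in sequentially. 2 \<le> n
    \<and> exp (- C) / (4 * (1 + exp C)) * real n powr (2 - \<gamma>) \<le> expected_edges (M n) n (A n)
    \<and> expected_edges (M n) n (A n) \<le> exp C * (1 + exp C)\<^sup>2 * real n powr (2 - \<gamma>)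
    \<and> prob_space.variance (M n) (\<lambda>\<omega>. num_edges n (A n \<omega>)) \<le> exp C * (1 + exp C)\<^sup>2 * real n powr (2 - \<gamma>)
    \<and> Max ((\<lambda>i. prob_space.variance (M n) (\<lambda>\<omega>. vertex_degree n (A n \<omega>) i)) ` {1..n})
        \<le> (exp C)\<^sup>2 * (1 + exp C) * real n powr (1 - \<gamma> + \<alpha>)"
  using regime
proof eventually_elim
  case (elim n)
  interpret sparse_beta_model "M n" n "A n" "\<mu>\<^sub>0 n" "\<beta>\<^sub>0 n"
    using model elim by blast
  have hyps: "0 \<le> \<gamma>" "0 \<le> \<alpha>" "2 \<le> n" "0 \<le> C" "\<bar>\<mu>\<^sub>0 n + \<gamma> * ln (real n)\<bar> \<le> C"
      "real (l0norm n (\<beta>\<^sub>0 n)) \<le> real n powr (1 - \<alpha>)"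
    using exponents C_nonneg elim by auto
  have hyp_\<beta>: "\<bar>\<beta>\<^sub>0 n i - \<alpha> * ln (real n)\<bar> \<le> C" if "i \<in> support n (\<beta>\<^sub>0 n)" for i
    using elim that by blast
  have "variance (\<lambda>\<omega>. vertex_degree n (A n \<omega>) i)
      \<le> (exp C)\<^sup>2 * (1 + exp C) * real n powr (1 - \<gamma> + \<alpha>)" if "i \<in> {1..n}" for i
    using variance_degree_le[OF that] expected_degree_upper[OF hyps(1-5) hyp_\<beta> hyps(6) that]
    by linarith
  then have "Max ((\<lambda>i. variance (\<lambda>\<omega>. vertex_degree n (A n \<omega>) i)) ` {1..n})
      \<le> (exp C)\<^sup>2 * (1 + exp C) * real n powr (1 - \<gamma> + \<alpha>)"
    using hyps(3) by (intro Max.boundedI) auto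
  moreover have "exp (- C) / (4 * (1 + exp C)) * real n powr (2 - \<gamma>) \<le> expected_edges (M n) n (A n)"
    by (rule expected_edges_lower[OF hyps(1-5) hyp_\<beta> hyps(6)])
  moreover have upper: "expected_edges (M n) n (A n) \<le> exp C * (1 + exp C)\<^sup>2 * real n powr (2 - \<gamma>)"
    by (rule expected_edges_upper[OF hyps(1-5) hyp_\<beta> hyps(6)])
  moreover have "variance (\<lambda>\<omega>. num_edges n (A n \<omega>)) \<le> exp C * (1 + exp C)\<^sup>2 * real n powr (2 - \<gamma>)"
    using variance_num_edges_le upper by linarith
  ultimately show ?case
    using hyps(3) by blast
qed

lemma expected_edges_same_order:
  "same_order (\<lambda>n. expected_edges (M n) n (A n)) (\<lambda>n. real n powr (2 - \<gamma>))"
proof (rule same_orderI)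
  show "0 < exp (- C) / (4 * (1 + exp C))"
    by (simp add: add_pos_pos)
  show "\<forall>\<^sub>F n in sequentially. 0 < real n powr (2 - \<gamma>)"
    using eventually_gt_at_top[of 0] by eventually_elim simp
qed (use eventually_bounds in \<open>eventually_elim, blast\<close>)+

text \<open>
  The probability \<open>1 - \<tau>\<close> and the constant \<open>K\<close> are the same for all large \<open>n\<close>, hence the bound at fixed \<open>n\<close>
  gives boundedness in probability. Nonnegativity of the excess risk turns it into a bound on the
  absolute value.
\<close>
lemma excess_risk_bigO:
  assumes mle: "\<And>n. 2 \<le> n \<Longrightarrow> 0 < M\<^sub>1 n \<and> 0 < M\<^sub>2 n \<and> s n \<in> {1..n - 1} \<and>
                constrained_mle (M n) n (A n) (M\<^sub>1 n) (M\<^sub>2 n) (s n) (\<theta>hat n)"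
  shows "bigO_in_prob M
           (\<lambda>n. excess_risk (M n) n (A n) (M\<^sub>1 n) (M\<^sub>2 n) (s n) (\<theta>hat n))
           (\<lambda>n. M\<^sub>1 n / real n powr (1 - \<gamma> / 2)
                + M\<^sub>2 n * real (s n) * sqrt (ln (real n))
                    / real n powr (3 / 2 - (\<gamma> + \<alpha>) / 2))"
proof (rule bigO_in_probI)
  fix \<tau> :: real assume \<tau>: "0 < \<tau>" "\<tau> < 1"
  define L where "L = ln (4 / \<tau>)"
  define q where "q = L / ln 2 + 1"
  define c where "c = exp (- C) / (4 * (1 + exp C))"
  define C\<^sub>1 where "C\<^sub>1 = exp C * (1 + exp C)\<^sup>2"
  define C\<^sub>2 where "C\<^sub>2 = (exp C)\<^sup>2 * (1 + exp C)"
  define K where "K = 2 / c * ((sqrt (2 * C\<^sub>1 * L) + L / 3)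
    + (sqrt (2 * C\<^sub>2 * q) + q / 3 * sqrt (1 / (1 - \<gamma> + \<alpha>))))"
  have L: "0 < L"
    using \<tau> by (simp add: L_def)
  have "0 < exp C + 1"
    by (simp add: add_pos_pos)
  then have const_pos: "0 < c" "0 < C\<^sub>1" "0 < C\<^sub>2"
    by (simp_all add: c_def C\<^sub>1_def C\<^sub>2_def add.commute)
  have q: "0 < q"
    using L by (simp add: q_def add_pos_pos)
  have "0 < K"
    unfolding K_def using L q const_pos exponents by (intro mult_pos_pos add_pos_nonneg add_pos_pos) auto
  moreover have "\<forall>\<^sub>F n in sequentially. 1 - \<tau> \<le> measure (M n) {\<omega> \<in> space (M n).
      \<bar>excess_risk (M n) n (A n) (M\<^sub>1 n) (M\<^sub>2 n) (s n) (\<theta>hat n) \<omega>\<bar>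
        \<le> K * (M\<^sub>1 n / real n powr (1 - \<gamma> / 2) + M\<^sub>2 n * real (s n) * sqrt (ln (real n))
                    / real n powr (3 / 2 - (\<gamma> + \<alpha>) / 2))}"
    using eventually_bounds
  proof eventually_elim
    case (elim n)
    then have n2: "2 \<le> n"
      by simp
    interpret sparse_beta_model "M n" n "A n" "\<mu>\<^sub>0 n" "\<beta>\<^sub>0 n"
      using model n2 by blast
    note mle_n = mle[OF n2]
    define V where "V = variance (\<lambda>\<omega>. num_edges n (A n \<omega>))"
    define W where "W = Max ((\<lambda>i. variance (\<lambda>\<omega>. vertex_degree n (A n \<omega>) i)) ` {1..n})"
    have "ln (4 * real n / \<tau>) = L + ln (real n)"
      using \<tau> n2 ln_mult[of "4 / \<tau>" "real n"] by (simp add: L_def mult.commute)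
    note upper = excess_risk_upper_bound[OF n2, of "M\<^sub>1 n" "M\<^sub>2 n" "s n" "\<theta>hat n", OF _ _ _ \<tau>,
        folded L_def V_def W_def, unfolded this]
    have rate: "2 / expected_edges (M n) n (A n) * (M\<^sub>1 n * (sqrt (2 * V * L) + L / 3)
        + M\<^sub>2 n * real (s n) * (sqrt (2 * W * (L + ln (real n))) + (L + ln (real n)) / 3))
      \<le> K * (M\<^sub>1 n / real n powr (1 - \<gamma> / 2) + M\<^sub>2 n * real (s n) * sqrt (ln (real n))
                    / real n powr (3 / 2 - (\<gamma> + \<alpha>) / 2))"
      unfolding K_def q_def
      by (rule excess_bound_le_rate)
        (use n2 L const_pos exponents mle_n elim in \<open>simp_all add: V_def W_def c_def C\<^sub>1_def C\<^sub>2_def\<close>)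
    have "1 - \<tau> \<le> prob {\<omega> \<in> space (M n).
        excess_risk (M n) n (A n) (M\<^sub>1 n) (M\<^sub>2 n) (s n) (\<theta>hat n) \<omega>
        \<le> 2 / expected_edges (M n) n (A n) * (M\<^sub>1 n * (sqrt (2 * V * L) + L / 3)
          + M\<^sub>2 n * real (s n) * (sqrt (2 * W * (L + ln (real n))) + (L + ln (real n)) / 3))}"
      using upper mle_n by blast
    also have "\<dots> \<le> prob {\<omega> \<in> space (M n).
      \<bar>excess_risk (M n) n (A n) (M\<^sub>1 n) (M\<^sub>2 n) (s n) (\<theta>hat n) \<omega>\<bar>
        \<le> K * (M\<^sub>1 n / real n powr (1 - \<gamma> / 2) + M\<^sub>2 n * real (s n) * sqrt (ln (real n))
                    / real n powr (3 / 2 - (\<gamma> + \<alpha>) / 2))}"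
    proof (rule finite_measure_mono)
      have [measurable]: "random_variable borel (excess_risk (M n) n (A n) (M\<^sub>1 n) (M\<^sub>2 n) (s n) (\<theta>hat n))"
        using excess_risk_measurable mle_n by blast
      show "{\<omega> \<in> space (M n).
        \<bar>excess_risk (M n) n (A n) (M\<^sub>1 n) (M\<^sub>2 n) (s n) (\<theta>hat n) \<omega>\<bar>
        \<le> K * (M\<^sub>1 n / real n powr (1 - \<gamma> / 2) + M\<^sub>2 n * real (s n) * sqrt (ln (real n))
                    / real n powr (3 / 2 - (\<gamma> + \<alpha>) / 2))} \<in> events"
        by measurable
      have "0 \<le> excess_risk (M n) n (A n) (M\<^sub>1 n) (M\<^sub>2 n) (s n) (\<theta>hat n) \<omega>" if "\<omega> \<in> space (M n)" for \<omega>
        using excess_risk_nonneg[OF n2] mle_n that by blast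
      then show "{\<omega> \<in> space (M n).
        excess_risk (M n) n (A n) (M\<^sub>1 n) (M\<^sub>2 n) (s n) (\<theta>hat n) \<omega>
        \<le> 2 / expected_edges (M n) n (A n) * (M\<^sub>1 n * (sqrt (2 * V * L) + L / 3)
          + M\<^sub>2 n * real (s n) * (sqrt (2 * W * (L + ln (real n))) + (L + ln (real n)) / 3))}
        \<subseteq> {\<omega> \<in> space (M n).
        \<bar>excess_risk (M n) n (A n) (M\<^sub>1 n) (M\<^sub>2 n) (s n) (\<theta>hat n) \<omega>\<bar>
        \<le> K * (M\<^sub>1 n / real n powr (1 - \<gamma> / 2) + M\<^sub>2 n * real (s n) * sqrt (ln (real n))
                    / real n powr (3 / 2 - (\<gamma> + \<alpha>) / 2))}"
        using rate by auto
    qed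
    finally show ?case .
  qed
  ultimately show "\<exists>K>0. \<forall>\<^sub>F n in sequentially. 1 - \<tau> \<le> measure (M n) {\<omega> \<in> space (M n).
      \<bar>excess_risk (M n) n (A n) (M\<^sub>1 n) (M\<^sub>2 n) (s n) (\<theta>hat n) \<omega>\<bar>
        \<le> K * (M\<^sub>1 n / real n powr (1 - \<gamma> / 2) + M\<^sub>2 n * real (s n) * sqrt (ln (real n))
                    / real n powr (3 / 2 - (\<gamma> + \<alpha>) / 2))}"
    by blast
qed

end

lemma sparse_regime_exists:
  assumes "\<And>n. 2 \<le> n \<Longrightarrow> sparse_beta_model (M n) n (A n) (\<mu>\<^sub>0 n) (\<beta>\<^sub>0 n)"
    and "0 \<le> \<gamma>" "\<gamma> < 2" "0 \<le> \<alpha>" "\<gamma> - \<alpha> < 1"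
    and \<mu>: "(\<lambda>n. \<mu>\<^sub>0 n - (- \<gamma> * ln (real n))) \<in> O(\<lambda>_. 1)"
    and \<beta>: "\<exists>C. \<forall>\<^sub>F n in sequentially. \<forall>i\<in>support n (\<beta>\<^sub>0 n). \<bar>\<beta>\<^sub>0 n i - \<alpha> * ln (real n)\<bar> \<le> C"
    and sparse: "(\<lambda>n. real (l0norm n (\<beta>\<^sub>0 n))) \<in> o(\<lambda>n. real n powr (1 - \<alpha>))"
  shows "\<exists>C. sparse_regime M A \<mu>\<^sub>0 \<beta>\<^sub>0 \<gamma> \<alpha> C"
proof -
  from \<mu> obtain c where c: "\<forall>\<^sub>F n in sequentially. \<bar>\<mu>\<^sub>0 n + \<gamma> * ln (real n)\<bar> \<le> c"
    by (auto elim!: landau_o.bigE)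
  from \<beta> obtain C where C: "\<forall>\<^sub>F n in sequentially. \<forall>i\<in>support n (\<beta>\<^sub>0 n). \<bar>\<beta>\<^sub>0 n i - \<alpha> * ln (real n)\<bar> \<le> C"
    by blast
  have "\<forall>\<^sub>F n in sequentially. real (l0norm n (\<beta>\<^sub>0 n)) \<le> real n powr (1 - \<alpha>)"
    using landau_o.smallD[OF sparse, of 1] by simp
  with c C eventually_ge_at_top[of 2]
  have "\<forall>\<^sub>F n in sequentially. 2 \<le> n \<and> \<bar>\<mu>\<^sub>0 n + \<gamma> * ln (real n)\<bar> \<le> max 0 (max c C)
      \<and> (\<forall>i\<in>support n (\<beta>\<^sub>0 n). \<bar>\<beta>\<^sub>0 n i - \<alpha> * ln (real n)\<bar> \<le> max 0 (max c C))
      \<and> real (l0norm n (\<beta>\<^sub>0 n)) \<le> real n powr (1 - \<alpha>)"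
    by eventually_elim (auto simp: le_max_iff_disj)
  then have "sparse_regime M A \<mu>\<^sub>0 \<beta>\<^sub>0 \<gamma> \<alpha> (max 0 (max c C))"
    using assms(1-5) by (intro sparse_regime.intro) simp_all
  then show ?thesis
    by blast
qed

theorem theorem2:
  "(\<forall>(M :: 'w measure) n A \<mu>\<^sub>0 \<beta>\<^sub>0 M\<^sub>1 M\<^sub>2 s \<theta>hat \<tau>.
      sparse_beta_model M n A \<mu>\<^sub>0 \<beta>\<^sub>0 \<longrightarrow>
      0 < M\<^sub>1 \<longrightarrow> 0 < M\<^sub>2 \<longrightarrow> s \<in> {1..n - 1} \<longrightarrow>
      constrained_mle M n A M\<^sub>1 M\<^sub>2 s \<theta>hat \<longrightarrow>
      0 < \<tau> \<longrightarrow> \<tau> < 1 \<longrightarrow>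
      measure M {\<omega> \<in> space M. excess_risk M n A M\<^sub>1 M\<^sub>2 s \<theta>hat \<omega> \<le>
          2 / expected_edges M n A *
            (M\<^sub>1 * (sqrt (2 * prob_space.variance M (\<lambda>\<omega>. num_edges n (A \<omega>)) * ln (4 / \<tau>))
                     + ln (4 / \<tau>) / 3)
             + M\<^sub>2 * real s *
                 (sqrt (2 * Max ((\<lambda>i. prob_space.variance M (\<lambda>\<omega>. vertex_degree n (A \<omega>) i)) ` {1..n})
                          * ln (4 * real n / \<tau>))
                     + ln (4 * real n / \<tau>) / 3))}
        \<ge> 1 - \<tau>)
   \<and>
   (\<forall>(M :: nat \<Rightarrow> 'v measure) A \<mu>\<^sub>0 \<beta>\<^sub>0 \<gamma> \<alpha>.
      (\<forall>n\<ge>2. sparse_beta_model (M n) n (A n) (\<mu>\<^sub>0 n) (\<beta>\<^sub>0 n)) \<longrightarrow>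
      0 \<le> \<gamma> \<longrightarrow> \<gamma> < 2 \<longrightarrow> 0 \<le> \<alpha> \<longrightarrow> \<alpha> < 1 \<longrightarrow> 0 \<le> \<gamma> - \<alpha> \<longrightarrow> \<gamma> - \<alpha> < 1 \<longrightarrow>
      (\<lambda>n. \<mu>\<^sub>0 n - (- \<gamma> * ln (real n))) \<in> O(\<lambda>_. 1) \<longrightarrow>
      (\<exists>C. \<forall>\<^sub>F n in sequentially. \<forall>i\<in>support n (\<beta>\<^sub>0 n). \<bar>\<beta>\<^sub>0 n i - \<alpha> * ln (real n)\<bar> \<le> C) \<longrightarrow>
      (\<lambda>n. real (l0norm n (\<beta>\<^sub>0 n))) \<in> o(\<lambda>n. real n powr (1 - \<alpha>)) \<longrightarrow>
      same_order (\<lambda>n. expected_edges (M n) n (A n)) (\<lambda>n. real n powr (2 - \<gamma>)) \<and>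
      (\<forall>M\<^sub>1 M\<^sub>2 s \<theta>hat.
         (\<forall>n\<ge>2. 0 < M\<^sub>1 n \<and> 0 < M\<^sub>2 n \<and> s n \<in> {1..n - 1} \<and>
                constrained_mle (M n) n (A n) (M\<^sub>1 n) (M\<^sub>2 n) (s n) (\<theta>hat n)) \<longrightarrow>
         bigO_in_prob M
           (\<lambda>n. excess_risk (M n) n (A n) (M\<^sub>1 n) (M\<^sub>2 n) (s n) (\<theta>hat n))
           (\<lambda>n. M\<^sub>1 n / real n powr (1 - \<gamma> / 2)
                + M\<^sub>2 n * real (s n) * sqrt (ln (real n))
                    / real n powr (3 / 2 - (\<gamma> + \<alpha>) / 2))))"
proof (intro conjI allI impI, goal_cases)
  case (1 M n A \<mu>\<^sub>0 \<beta>\<^sub>0 M\<^sub>1 M\<^sub>2 s \<theta>hat \<tau>)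
  then show ?case
    by (intro sparse_beta_model.excess_risk_upper_bound) auto
next
  case (2 M A \<mu>\<^sub>0 \<beta>\<^sub>0 \<gamma> \<alpha>)
  then have "\<exists>C. sparse_regime M A \<mu>\<^sub>0 \<beta>\<^sub>0 \<gamma> \<alpha> C"
    by (intro sparse_regime_exists) blast+
  then obtain C where "sparse_regime M A \<mu>\<^sub>0 \<beta>\<^sub>0 \<gamma> \<alpha> C" ..
  then show ?case
    by (rule sparse_regime.expected_edges_same_order)
next
  case (3 M A \<mu>\<^sub>0 \<beta>\<^sub>0 \<gamma> \<alpha> M\<^sub>1 M\<^sub>2 s \<theta>hat)
  then have "\<exists>C. sparse_regime M A \<mu>\<^sub>0 \<beta>\<^sub>0 \<gamma> \<alpha> C"
    by (intro sparse_regime_exists) blast+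
  then obtain C where "sparse_regime M A \<mu>\<^sub>0 \<beta>\<^sub>0 \<gamma> \<alpha> C" ..
  then show ?case
    by (rule sparse_regime.excess_risk_bigO) (use 3 in auto)
qed

end
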